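(* Let $M_0$ be an irreducible Markov matrix on a finite set $E$, reversible with respect to a probability $\pi_0$, let $U:E\to\mathbb R$, and let $(\beta_n)$ be a sequence of positive numbers. Let $(X_n)$ be the Markov chain with rare transitions on $E$ with transition matrices $M_n=M(\beta_n,\cdot,\cdot)$, i.e. $\mathsf P(X_{n+1}=y\mid\mathcal F_n)=M_n(X_n,y)$, where $$M(\beta,x,y)=M_0(x,y)\,\psi\big[\exp(-\beta(U(y)-U(x)))\big]\ \ (x\ne y),\qquad M(\beta,x,x)=1-\sum_{y\ne x}M(\beta,x,y).$$ Assume that $\beta_n=\beta(n)$, where $\beta:\mathbb R^+\to\mathbb R^+$ is differentiable and satisfies $$0\le\dot\beta(t)\le\frac At$$ for some $A<\frac1{2U^{\#}}$. Let $v_n=\frac1n\sum_{i=1}^n\delta_{X_i}$. Then, almost surely, $v_n\to\pi$, where $\pi$ is the probability with $$\pi(x)\propto\pi_0(x)\mathbf 1_{\mathsf{Argmin}\,U}(x).$$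
   Context: Reversibility: $\pi_0(x)M_0(x,y)=\pi_0(y)M_0(y,x)$ for all $x,y$. The function $\psi$ is either $\psi(u)=\min(1,u)$ or $\psi(u)=\frac{u}{1+u}$. $(X_n)$ is adapted to a filtration $(\mathcal F_n)$. $\mathsf{Argmin}\,U$ is the set of global minimizers of $U$. A path from $x$ to $y$ is a sequence $x_0=x,x_1,\dots,x_n=y$ with $M_0(x_i,x_{i+1})>0$; $\Gamma_{x,y}$ is the set of all such paths. $\mathsf{Elev}(x,y)=\min\{\max\{U(z):z\in\gamma\}:\gamma\in\Gamma_{x,y}\}$, and the energy barrier is $$U^{\#}=\max\{\mathsf{Elev}(x,y)-U(x)-U(y)+\min U:\ x,y\in E\}.$$
   Formalization: The formal theorem also assumes that β_n → ∞ (the meaning of "rare transitions"); without it the claim fails, e.g. for constant β the measures v_n converge to a Gibbs law charging every point. *)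

theory Defs
  imports "HOL-Probability.Probability" "HOL-Probability.Conditional_Expectation"
    "HOL-Probability.Stopping_Time"
begin

text \<open>The finite state space \<open>E\<close> is a type of class \<^class>\<open>finite\<close>; probability measures on
  it are identified with their weight functions, so that weak convergence of such measures is
  pointwise convergence of the weights.\<close>

definition prob_vector :: "('e::finite \<Rightarrow> real) \<Rightarrow> bool" where
  "prob_vector p \<longleftrightarrow> (\<forall>x. 0 \<le> p x) \<and> (\<Sum>x\<in>UNIV. p x) = 1"

definition markov_matrix :: "('e::finite \<Rightarrow> 'e \<Rightarrow> real) \<Rightarrow> bool" where
  "markov_matrix K \<longleftrightarrow> (\<forall>x. prob_vector (K x))"

definition reversible_wrt :: "('e::finite \<Rightarrow> 'e \<Rightarrow> real) \<Rightarrow> ('e \<Rightarrow> real) \<Rightarrow> bool" where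
  "reversible_wrt K p \<longleftrightarrow> (\<forall>x y. p x * K x y = p y * K y x)"

text \<open>A path \<open>x\<^sub>0, \<dots>, x\<^sub>n\<close> is the nonempty list of its vertices; the case \<open>n = 0\<close> is allowed.\<close>

definition paths :: "('e::finite \<Rightarrow> 'e \<Rightarrow> real) \<Rightarrow> 'e \<Rightarrow> 'e \<Rightarrow> 'e list set" where
  "paths K x y =
    {\<gamma>. \<gamma> \<noteq> [] \<and> hd \<gamma> = x \<and> last \<gamma> = y \<and> successively (\<lambda>u v. 0 < K u v) \<gamma>}"

definition irreducible_matrix :: "('e::finite \<Rightarrow> 'e \<Rightarrow> real) \<Rightarrow> bool" where
  "irreducible_matrix K \<longleftrightarrow> (\<forall>x y. paths K x y \<noteq> {})"

text \<open>The set of paths may be infinite, but the set of their heights is finite, being contained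
  in the range of \<open>U\<close>; hence \<^const>\<open>Min\<close> is meaningful as soon as there is a path.\<close>

definition elev :: "('e::finite \<Rightarrow> 'e \<Rightarrow> real) \<Rightarrow> ('e \<Rightarrow> real) \<Rightarrow> 'e \<Rightarrow> 'e \<Rightarrow> real" where
  "elev K U x y = Min ((\<lambda>\<gamma>. Max (U ` set \<gamma>)) ` paths K x y)"

definition energy_barrier :: "('e::finite \<Rightarrow> 'e \<Rightarrow> real) \<Rightarrow> ('e \<Rightarrow> real) \<Rightarrow> real" where
  "energy_barrier K U = Max (range (\<lambda>(x, y). elev K U x y - U x - U y + Min (range U)))"

definition Argmin :: "('e::finite \<Rightarrow> real) \<Rightarrow> 'e set" where
  "Argmin U = {x. \<forall>y. U x \<le> U y}"

definition annealed_matrix ::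
  "('e::finite \<Rightarrow> 'e \<Rightarrow> real) \<Rightarrow> ('e \<Rightarrow> real) \<Rightarrow> (real \<Rightarrow> real) \<Rightarrow> real \<Rightarrow> 'e \<Rightarrow> 'e \<Rightarrow> real" where
  "annealed_matrix K U \<psi> b x y =
    (if x \<noteq> y then K x y * \<psi> (exp (- b * (U y - U x)))
     else 1 - (\<Sum>z\<in>UNIV - {x}. K x z * \<psi> (exp (- b * (U z - U x)))))"

definition inhomogeneous_chain ::
  "'w measure \<Rightarrow> (nat \<Rightarrow> 'w measure) \<Rightarrow> (nat \<Rightarrow> 'w \<Rightarrow> 'e::finite) \<Rightarrow>
    (nat \<Rightarrow> 'e \<Rightarrow> 'e \<Rightarrow> real) \<Rightarrow> bool" where
  "inhomogeneous_chain P F X K \<longleftrightarrow>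
    filtration (space P) F \<and> (\<forall>n. subalgebra P (F n)) \<and>
    (\<forall>n. X n \<in> measurable (F n) (count_space UNIV)) \<and>
    (\<forall>n y. AE w in P.
      real_cond_exp P (F n) (\<lambda>w. indicator {y} (X (Suc n) w)) w = K n (X n w) y)"

definition empirical_occupation :: "(nat \<Rightarrow> 'w \<Rightarrow> 'e::finite) \<Rightarrow> nat \<Rightarrow> 'w \<Rightarrow> 'e \<Rightarrow> real" where
  "empirical_occupation X n w x = (\<Sum>i=1..n. indicator {X i w} x) / real n"

definition argmin_law :: "('e::finite \<Rightarrow> real) \<Rightarrow> ('e \<Rightarrow> real) \<Rightarrow> 'e \<Rightarrow> real" where
  "argmin_law p U x =
    p x * indicator (Argmin U) x / (\<Sum>z\<in>UNIV. p z * indicator (Argmin U) z)"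

end

theory Submission
  imports Defs "HOL-Real_Asymp.Real_Asymp"
begin

text \<open>
  Let \<open>K\<^sub>n\<close> be the annealed matrix at time \<open>n\<close>. It is reversible with respect to the Gibbs law
  \<open>\<pi>\<^sub>n\<close>, proportional to \<open>\<pi>0 x * exp (- \<beta>\<^sub>n U x)\<close>, and \<open>\<pi>\<^sub>n\<close> converges to the claimed limit
  (\<open>gibbs_tendsto_argmin_law\<close>). Hence it suffices that the averages of \<open>f (X\<^sub>i) - \<pi>\<^sub>i f\<close> tend to \<open>0\<close>
  for each indicator \<open>f\<close>. For this, solve Poisson's equation \<open>(I - K\<^sub>n) g\<^sub>n = f - \<pi>\<^sub>n f\<close> with
  \<open>g\<^sub>n = 0\<close> at a fixed global minimizer \<open>r\<close> of \<open>U\<close>, and write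
  \<open>f (X\<^sub>i) - \<pi>\<^sub>i f = g\<^sub>i (X\<^sub>i) - (K\<^sub>i g\<^sub>i) (X\<^sub>i)\<close> as a martingale increment plus a difference
  that telescopes up to the drift \<open>g\<^sub>i\<^sub>+\<^sub>1 - g\<^sub>i\<close> (\<open>poisson_decomposition\<close>).

  Everything rests on the estimate that the supremum norm of \<open>g\<close> is at most a constant times
  \<open>exp (\<beta> H)\<close> times that of \<open>(I - K) g\<close>, where \<open>H\<close> is the energy barrier and \<open>g r = 0\<close>. A
  spectral gap would give this only in the Gibbs-weighted square norm. The proof
  here is by level sets: the flow out of \<open>{g > s}\<close> is bounded by the mass of that set, while
  a lowest path from the deepest point of the set down to \<open>r\<close> crosses its boundary at an
  edge of large conductance, along which \<open>g\<close> can therefore jump only a little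
  (\<open>annealed_bottleneck\<close>, \<open>bottleneck_osc_bound\<close>). The sorted values of \<open>g\<close> then have
  no large gaps, and there are only finitely many of them.

  Since \<open>\<beta>\<^sub>n\<close> is at most \<open>A ln n\<close> plus a constant, the estimate gives \<open>g\<^sub>n\<close> of order \<open>n\<^sup>a\<close> with
  \<open>a = A H < 1/2\<close>. Applied to \<open>g\<^sub>n\<^sub>+\<^sub>1 - g\<^sub>n\<close>, it gives a drift of order \<open>n\<^sup>2\<^sup>a\<^sup>-\<^sup>1\<close>
  (\<open>poisson_perturbation\<close>), because \<open>K\<^sub>n\<close> changes by \<open>O(1/n)\<close>; this tends to \<open>0\<close>. The averaged martingale
  part has variance of the same order \<open>n\<^sup>2\<^sup>a\<^sup>-\<^sup>1\<close>. Along a sparse sequence of powers the variances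
  are summable, so it tends to \<open>0\<close> almost surely there, and boundedness of \<open>f\<close> allows one
  to interpolate (\<open>ergodic_average_tendsto\<close>). Both uses of the condition on \<open>A\<close> are thus
  the inequality \<open>2 a < 1\<close>.
\<close>

section \<open>Poisson's equation on a finite reversible network\<close>

definition laplacian :: "('e::finite \<Rightarrow> 'e \<Rightarrow> real) \<Rightarrow> ('e \<Rightarrow> real) \<Rightarrow> 'e \<Rightarrow> real" where
  "laplacian K g x = g x - (\<Sum>y\<in>UNIV. K x y * g y)"

lemma markov_matrix_row_sum: "markov_matrix K \<Longrightarrow> (\<Sum>y\<in>UNIV. K x y) = 1"
  by (simp add: markov_matrix_def prob_vector_def)

lemma markov_matrix_nonneg: "markov_matrix K \<Longrightarrow> 0 \<le> K x y"
  by (simp add: markov_matrix_def prob_vector_def)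

lemma laplacian_diff: "laplacian K (\<lambda>x. f x - g x) x = laplacian K f x - laplacian K g x"
  by (simp add: laplacian_def right_diff_distrib sum_subtractf)

text \<open>Green's formula for a set \<open>S\<close>: by detailed balance the contributions of pairs inside \<open>S\<close>
  are antisymmetric and cancel, so only the flow out of \<open>S\<close> survives.\<close>

lemma laplacian_cut:
  assumes K: "markov_matrix K" and rev: "reversible_wrt K m"
  shows "(\<Sum>x\<in>S. m x * laplacian K g x) = (\<Sum>x\<in>S. \<Sum>y\<in>-S. m x * K x y * (g x - g y))"
proof -
  have lap: "m x * laplacian K g x = (\<Sum>y\<in>S. m x * K x y * (g x - g y)) +
      (\<Sum>y\<in>-S. m x * K x y * (g x - g y))" for x
  proof -
    have "m x * laplacian K g x = (\<Sum>y\<in>UNIV. m x * K x y * (g x - g y))"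
      using markov_matrix_row_sum[OF K, of x]
      by (simp add: laplacian_def algebra_simps sum_subtractf sum_distrib_left flip: sum_distrib_right)
         (simp add: mult.assoc flip: sum_distrib_left)
    also have "\<dots> = (\<Sum>y\<in>S \<union> -S. m x * K x y * (g x - g y))" by simp
    finally show ?thesis by (subst (asm) sum.union_disjoint) auto
  qed
  let ?I = "\<Sum>x\<in>S. \<Sum>y\<in>S. m x * K x y * (g x - g y)"
  have "?I = (\<Sum>y\<in>S. \<Sum>x\<in>S. m x * K x y * (g x - g y))" by (rule sum.swap)
  also have "\<dots> = (\<Sum>y\<in>S. \<Sum>x\<in>S. - (m y * K y x * (g y - g x)))"
    using rev by (intro sum.cong refl) (simp add: reversible_wrt_def right_diff_distrib)
  also have "\<dots> = - ?I" by (simp add: sum_negf)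
  finally have "?I = 0" by simp
  then show ?thesis by (simp add: lap sum.distrib)
qed

lemma mean_laplacian:
  assumes "markov_matrix K" "reversible_wrt K m"
  shows "(\<Sum>x\<in>UNIV. m x * laplacian K g x) = 0"
  using laplacian_cut[OF assms, where S=UNIV] by simp

text \<open>The number \<open>R\<close> is an isoperimetric constant: every nonempty set avoiding the root \<open>r\<close> is left
  by a single edge whose conductance is at least \<open>1 / R\<close> times the mass of the set. One edge is
  enough, since constants depending on the number of states are harmless here.\<close>

definition bottleneck ::
  "('e::finite \<Rightarrow> 'e \<Rightarrow> real) \<Rightarrow> ('e \<Rightarrow> real) \<Rightarrow> 'e \<Rightarrow> real \<Rightarrow> bool" where
  "bottleneck K m r R \<longleftrightarrow> 0 \<le> R \<and>
    (\<forall>S. S \<noteq> {} \<longrightarrow> r \<notin> S \<longrightarrow>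
      (\<exists>u\<in>S. \<exists>v\<in>-S. 0 < m u * K u v \<and> sum m S \<le> R * (m u * K u v)))"

text \<open>The values of \<open>g\<close> cannot have large gaps. The flow out of the superlevel set \<open>{g > s}\<close> is the
  integral of the Laplacian over it, hence at most \<open>e\<close> times its mass; every edge carries a
  nonnegative part of this flow, and so along the good edge provided by the bottleneck
  property \<open>g\<close> drops by at most \<open>R * e\<close>.\<close>

lemma bottleneck_level_step:
  assumes K: "markov_matrix K" and rev: "reversible_wrt K m" and m: "\<And>x. 0 \<le> m x"
    and R: "bottleneck K m r R" and lap: "\<And>x. \<bar>laplacian K g x\<bar> \<le> e"
    and s: "g r \<le> s" "s < g z"
  obtains u where "s < g u" "g u \<le> s + R * e"
proof -
  define S where "S = {x. s < g x}"
  have "S \<noteq> {}" "r \<notin> S" using s by (auto simp: S_def)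
  with R obtain u v where uv: "u \<in> S" "v \<in> -S" "0 < m u * K u v" "sum m S \<le> R * (m u * K u v)"
    unfolding bottleneck_def by blast
  have e: "0 \<le> e" using lap[of r] by linarith
  have nonneg: "0 \<le> m x * K x y * (g x - g y)" if "x \<in> S" "y \<in> -S" for x y
    using that m markov_matrix_nonneg[OF K] by (auto simp: S_def intro!: mult_nonneg_nonneg)
  have "m u * K u v * (g u - g v) \<le> (\<Sum>y\<in>-S. m u * K u y * (g u - g y))"
    using uv nonneg by (intro member_le_sum) auto
  also have "\<dots> \<le> (\<Sum>x\<in>S. \<Sum>y\<in>-S. m x * K x y * (g x - g y))"
    using uv nonneg by (intro member_le_sum[where f="\<lambda>x. \<Sum>y\<in>-S. m x * K x y * (g x - g y)"])
      (auto intro!: sum_nonneg)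
  also have "\<dots> = (\<Sum>x\<in>S. m x * laplacian K g x)"
    by (simp add: laplacian_cut[OF K rev])
  also have "\<dots> \<le> (\<Sum>x\<in>S. m x * e)"
    using lap m by (intro sum_mono mult_left_mono) (auto simp: abs_le_iff)
  also have "\<dots> = sum m S * e" by (simp add: sum_distrib_right)
  also have "\<dots> \<le> R * (m u * K u v) * e" using uv e by (intro mult_right_mono) auto
  finally have "m u * K u v * (g u - g v) \<le> m u * K u v * (R * e)" by (simp add: mult_ac)
  then have "g u - g v \<le> R * e" using uv(3) by (simp only: mult_le_cancel_left_pos)
  moreover have "s < g u" "g v \<le> s" using uv by (auto simp: S_def)
  ultimately show ?thesis using that[of u] by linarith
qed

text \<open>If \<open>g\<close> exceeded \<open>g r\<close> by more than \<open>CARD('e)\<close> steps of height \<open>R * e\<close>, each of the steps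
  \<open>0, \<dots>, CARD('e)\<close> would contain a value of \<open>g\<close>: one value too many.\<close>

lemma bottleneck_upper_bound:
  fixes K :: "'e::finite \<Rightarrow> 'e \<Rightarrow> real"
  assumes K: "markov_matrix K" and rev: "reversible_wrt K m" and m: "\<And>x. 0 \<le> m x"
    and R: "bottleneck K m r R" and lap: "\<And>x. \<bar>laplacian K g x\<bar> \<le> e"
  shows "g z \<le> g r + real CARD('e) * (R * e)"
proof (rule ccontr)
  assume *: "\<not> ?thesis"
  have e: "0 \<le> e" using lap[of r] by linarith
  have B: "0 \<le> R * e" using R e by (auto simp: bottleneck_def)
  have "\<exists>u. g r + real k * (R * e) < g u \<and> g u \<le> g r + real (Suc k) * (R * e)"
    if "k \<le> CARD('e)" for k
  proof -
    have "real k * (R * e) \<le> real CARD('e) * (R * e)"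
      using that B by (intro mult_right_mono) auto
    then have "g r + real k * (R * e) < g z" using * by linarith
    moreover have "g r \<le> g r + real k * (R * e)" using B by simp
    ultimately obtain u where "g r + real k * (R * e) < g u" "g u \<le> g r + real k * (R * e) + R * e"
      using bottleneck_level_step[OF K rev m R lap] by metis
    then show ?thesis by (intro exI[of _ u]) (simp add: distrib_right)
  qed
  then obtain u where u: "\<And>k. k \<le> CARD('e) \<Longrightarrow>
      g r + real k * (R * e) < g (u k) \<and> g (u k) \<le> g r + real (Suc k) * (R * e)" by metis
  have less: "g (u k) < g (u l)" if "k < l" "l \<le> CARD('e)" for k l
  proof -
    have "real (Suc k) * (R * e) \<le> real l * (R * e)"
      using that B by (intro mult_right_mono) auto
    then show ?thesis using u[of k] u[of l] that by fastforce
  qed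
  have "inj_on u {..CARD('e)}"
    by (rule inj_onI) (metis atMost_iff less linorder_neqE_nat order_less_irrefl)
  from card_inj_on_le[OF this subset_UNIV] show False by simp
qed

text \<open>This a priori estimate is the substitute for a spectral gap. It works directly in the supremum
  norm, so nothing is lost in comparing with a norm weighted by \<open>m\<close>, whose smallest weights
  are exponentially small at low temperature.\<close>

lemma bottleneck_osc_bound:
  fixes K :: "'e::finite \<Rightarrow> 'e \<Rightarrow> real"
  assumes "markov_matrix K" "reversible_wrt K m" "\<And>x. 0 \<le> m x"
    and "bottleneck K m r R" and lap: "\<And>x. \<bar>laplacian K g x\<bar> \<le> e"
  shows "\<bar>g z - g r\<bar> \<le> real CARD('e) * (R * e)"
proof -
  have "\<bar>laplacian K (\<lambda>x. - g x) x\<bar> \<le> e" for x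
    using lap[of x] by (simp add: laplacian_def sum_negf)
  from bottleneck_upper_bound[OF assms(1-4) this, of z] bottleneck_upper_bound[OF assms, of z]
  show ?thesis by linarith
qed

text \<open>The rank-one perturbation \<open>v \<mapsto> laplacian K v + v r\<close> is injective: pairing with \<open>m\<close> kills the
  Laplacian and shows that \<open>v r\<close> is the \<open>m\<close>-mean of the image, and then the oscillation bound
  with \<open>e = 0\<close> applies. In finite dimension it is therefore onto.\<close>

lemma poisson_solution:
  fixes K :: "'e::finite \<Rightarrow> 'e \<Rightarrow> real"
  assumes K: "markov_matrix K" and rev: "reversible_wrt K m" and m: "\<And>x. 0 \<le> m x"
    and R: "bottleneck K m r R" and pos: "0 < sum m UNIV"
  obtains g where "g r = 0"
    "\<And>x. laplacian K g x = f x - (\<Sum>y\<in>UNIV. m y * f y) / sum m UNIV"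
proof -
  define T :: "real ^ 'e \<Rightarrow> real ^ 'e" where "T v = (\<chi> x. laplacian K (($) v) x + v $ r)" for v
  have lin: "linear T"
    by (rule linearI) (simp_all add: T_def laplacian_def vec_eq_iff algebra_simps
        sum.distrib sum_distrib_left)
  have root: "v $ r * sum m UNIV = (\<Sum>x\<in>UNIV. m x * T v $ x)" for v
    using laplacian_cut[OF K rev, where S=UNIV and g="($) v"]
    by (simp add: T_def distrib_left sum.distrib mult.commute flip: sum_distrib_right)
  have "inj T"
    unfolding linear_injective_0[OF lin]
  proof (intro allI impI)
    fix v assume Tv: "T v = 0"
    then have r: "v $ r = 0" using root[of v] pos by simp
    have "\<bar>laplacian K (($) v) x\<bar> \<le> 0" for x
      using arg_cong[OF Tv, of "\<lambda>w. w $ x"] r by (simp add: T_def)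
    from bottleneck_osc_bound[OF K rev m R this] r show "v = 0" by (simp add: vec_eq_iff)
  qed
  then have "surj T" using lin by (simp add: linear_injective_imp_surjective)
  then obtain v where v: "T v = (\<chi> x. f x)" by (metis surjD)
  have vr: "v $ r = (\<Sum>y\<in>UNIV. m y * f y) / sum m UNIV"
    using root[of v] pos by (simp add: v field_simps)
  show thesis
  proof (rule that[of "\<lambda>x. v $ x - v $ r"])
    show "v $ r - v $ r = 0" by simp
    fix x
    have "laplacian K (\<lambda>x. v $ x - v $ r) x = laplacian K (($) v) x"
      using markov_matrix_row_sum[OF K, of x]
      by (simp add: laplacian_def right_diff_distrib sum_subtractf flip: sum_distrib_right)
    also have "\<dots> = f x - v $ r"
      using arg_cong[OF v, of "\<lambda>w. w $ x"] by (simp add: T_def)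
    finally show "laplacian K (\<lambda>x. v $ x - v $ r) x = f x - (\<Sum>y\<in>UNIV. m y * f y) / sum m UNIV"
      by (simp add: vr)
  qed
qed

text \<open>The difference of two solutions solves a Poisson equation for \<open>K'\<close> whose right-hand side is
  \<open>(K' - K) g\<close> plus the constant \<open>c - c'\<close>. That constant needs no separate estimate: the
  right-hand side has \<open>m'\<close>-mean zero, so the constant is no larger than \<open>(K' - K) g\<close>.\<close>

lemma poisson_perturbation:
  fixes K :: "'e::finite \<Rightarrow> 'e \<Rightarrow> real"
  assumes K': "markov_matrix K'" "reversible_wrt K' m'" "\<And>x. 0 \<le> m' x" "0 < sum m' UNIV"
    and R: "bottleneck K' m' r R"
    and g: "\<And>x. laplacian K g x = f x - c" "\<And>x. \<bar>g x\<bar> \<le> G"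
    and g': "\<And>x. laplacian K' g' x = f x - c'"
    and r: "g r = g' r"
    and d: "\<And>x y. \<bar>K' x y - K x y\<bar> \<le> d"
  shows "\<bar>g' z - g z\<bar> \<le> 2 * (real CARD('e))\<^sup>2 * R * d * G"
proof -
  define h where "h x = laplacian K g x - laplacian K' g x" for x
  have G: "0 \<le> G" using g(2)[of r] by linarith
  have h_bound: "\<bar>h x\<bar> \<le> real CARD('e) * (d * G)" for x
  proof -
    have "\<bar>h x\<bar> = \<bar>\<Sum>y\<in>UNIV. (K' x y - K x y) * g y\<bar>"
      by (simp add: h_def laplacian_def left_diff_distrib sum_subtractf)
    also have "\<dots> \<le> (\<Sum>y\<in>(UNIV :: 'e set). d * G)"
      using d g(2) G by (intro order_trans[OF sum_abs] sum_mono) (auto simp: abs_mult intro!: mult_mono')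
    finally show ?thesis by simp
  qed
  have lap: "laplacian K' (\<lambda>x. g' x - g x) x = h x + (c - c')" for x
    by (simp add: laplacian_diff h_def g g')
  have "(\<Sum>x\<in>UNIV. m' x * (h x + (c - c'))) = 0"
    using mean_laplacian[OF K'(1,2), of "\<lambda>x. g' x - g x"] by (simp add: lap)
  then have "(c' - c) * sum m' UNIV = (\<Sum>x\<in>UNIV. m' x * h x)"
    by (simp add: algebra_simps sum.distrib sum_subtractf flip: sum_distrib_left sum_distrib_right)
  then have "\<bar>c' - c\<bar> * sum m' UNIV = \<bar>\<Sum>x\<in>UNIV. m' x * h x\<bar>"
    using K'(4) by (metis abs_mult abs_of_pos)
  also have "\<dots> \<le> (\<Sum>x\<in>UNIV. m' x * (real CARD('e) * (d * G)))"
    using h_bound K'(3) by (intro order_trans[OF sum_abs] sum_mono) (auto simp: abs_mult intro!: mult_left_mono)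
  also have "\<dots> = (real CARD('e) * (d * G)) * sum m' UNIV"
    by (subst mult.commute) (rule sum_distrib_right[symmetric])
  finally have c: "\<bar>c' - c\<bar> \<le> real CARD('e) * (d * G)" using K'(4) by simp
  have "\<bar>laplacian K' (\<lambda>x. g' x - g x) x\<bar> \<le> 2 * (real CARD('e) * (d * G))" for x
    using h_bound[of x] c unfolding lap by linarith
  from bottleneck_osc_bound[OF K'(1-3) R this, of z]
  show ?thesis using r by (simp add: power2_eq_square mult_ac)
qed

section \<open>Metropolis and Barker dynamics at a fixed temperature\<close>

text \<open>What the two acceptance rules have in common, expressed in terms of the log-ratio
  \<open>s = -\<beta> (U y - U x)\<close>: detailed balance, comparability with the Metropolis rule, and
  dependence on \<open>s\<close> with Lipschitz constant \<open>1\<close>.\<close>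

definition acceptance_function :: "(real \<Rightarrow> real) \<Rightarrow> bool" where
  "acceptance_function \<psi> \<longleftrightarrow> (\<forall>s. 0 < \<psi> (exp s) \<and> \<psi> (exp s) \<le> 1 \<and>
     \<psi> (exp s) = exp s * \<psi> (exp (- s)) \<and> min 1 (exp s) \<le> 2 * \<psi> (exp s)) \<and>
     (\<forall>s t. \<bar>\<psi> (exp s) - \<psi> (exp t)\<bar> \<le> \<bar>s - t\<bar>)"

lemma
  assumes "acceptance_function \<psi>"
  shows acceptance_pos: "0 < \<psi> (exp s)"
    and acceptance_le_1: "\<psi> (exp s) \<le> 1"
    and acceptance_balance: "\<psi> (exp s) = exp s * \<psi> (exp (- s))"
    and acceptance_lower: "min 1 (exp s) \<le> 2 * \<psi> (exp s)"
    and acceptance_lipschitz: "\<bar>\<psi> (exp s) - \<psi> (exp t)\<bar> \<le> \<bar>s - t\<bar>"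
  using assms unfolding acceptance_function_def by blast+

lemma metropolis_acceptance: "acceptance_function (\<lambda>u. min 1 u)"
proof -
  have "\<bar>min 1 (exp s) - min 1 (exp t)\<bar> \<le> \<bar>s - t\<bar>" for s t :: real
  proof (induction s t rule: linorder_wlog)
    case (le s t)
    have "exp t - exp s \<le> t - s" if "t \<le> 0"
    proof -
      have "1 + (s - t) \<le> exp (s - t)" by (rule exp_ge_add_one_self)
      then have "1 - exp (s - t) \<le> t - s" by linarith
      then have "exp t * (1 - exp (s - t)) \<le> 1 * (t - s)"
        using that le by (intro mult_mono) simp_all
      then show ?thesis by (simp add: exp_diff right_diff_distrib)
    qed
    moreover have "1 - exp s \<le> t - s" if "0 \<le> t" "s \<le> 0"
      using exp_ge_add_one_self[of s] that by linarith
    ultimately show ?case using le by (cases "t \<le> 0"; cases "s \<le> 0") (auto simp: min_def)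
  next
    case (sym s t)
    then show ?case by (simp add: abs_minus_commute)
  qed
  then show ?thesis
    by (auto simp: acceptance_function_def min_def exp_minus field_simps)
qed

lemma barker_acceptance: "acceptance_function (\<lambda>u. u / (1 + u))"
proof -
  have *: "\<bar>exp s / (1 + exp s) - exp t / (1 + exp t)\<bar> \<le> \<bar>s - t\<bar>" for s t :: real
  proof (induction s t rule: linorder_wlog)
    case (le s t)
    have pos: "0 < 1 + exp s" "0 < 1 + exp t" by (simp_all add: add_pos_pos)
    have "1 + (s - t) \<le> exp (s - t)" by (rule exp_ge_add_one_self)
    then have "1 - exp (s - t) \<le> t - s" by linarith
    then have 1: "exp t * (1 - exp (s - t)) \<le> exp t * (t - s)"
      by (rule mult_left_mono) simp
    have "exp t \<le> (1 + exp s) * (1 + exp t)"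
      by (simp add: algebra_simps add_pos_pos less_imp_le)
    then have "exp t * (t - s) \<le> (1 + exp s) * (1 + exp t) * (t - s)"
      using le by (intro mult_right_mono) auto
    with 1 have "exp t - exp s \<le> (1 + exp s) * (1 + exp t) * (t - s)"
      by (simp add: exp_diff right_diff_distrib)
    moreover have "exp t / (1 + exp t) - exp s / (1 + exp s) = (exp t - exp s) / ((1 + exp s) * (1 + exp t))"
      using pos by (simp add: field_simps)
    ultimately have "exp t / (1 + exp t) - exp s / (1 + exp s) \<le> t - s"
      using pos by (simp add: pos_divide_le_eq mult_ac)
    moreover have "exp s / (1 + exp s) \<le> exp t / (1 + exp t)"
      using le pos by (simp add: field_simps)
    ultimately show ?case using le by (simp add: abs_if)
  next
    case (sym s t)
    then show ?case by (simp add: abs_minus_commute)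
  qed
  have pos: "0 < 1 + exp s" for s :: real by (simp add: add_pos_pos)
  have 1: "exp s / (1 + exp s) = exp s * (exp (- s) / (1 + exp (- s)))" for s :: real
    using pos[of s] pos[of "-s"] by (simp add: exp_minus field_simps)
  have 2: "min 1 (exp s) \<le> 2 * (exp s / (1 + exp s))" for s :: real
  proof (cases "s \<le> 0")
    case True
    then have "exp s * (1 + exp s) \<le> exp s * 2" by (intro mult_left_mono) auto
    then show ?thesis using pos[of s] True by (simp add: min_def pos_le_divide_eq mult.commute)
  next
    case False
    then have "1 + exp s \<le> 2 * exp s" by simp
    then show ?thesis using pos[of s] False by (simp add: min_def pos_le_divide_eq)
  qed
  show ?thesis
    unfolding acceptance_function_def
    by (intro conjI allI 1 2 *) (simp_all add: pos less_imp_le)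
qed

definition gibbs :: "('e \<Rightarrow> real) \<Rightarrow> ('e \<Rightarrow> real) \<Rightarrow> real \<Rightarrow> 'e \<Rightarrow> real" where
  "gibbs p U b x = p x * exp (- (b * U x))"

lemma annealed_off_diagonal:
  "x \<noteq> y \<Longrightarrow> annealed_matrix K U \<psi> b x y = K x y * \<psi> (exp (- b * (U y - U x)))"
  by (simp add: annealed_matrix_def)

lemma annealed_markov:
  assumes K: "markov_matrix K" and \<psi>: "acceptance_function \<psi>"
  shows "markov_matrix (annealed_matrix K U \<psi> b)"
  unfolding markov_matrix_def prob_vector_def
proof (intro allI conjI)
  fix x y
  have acc: "0 \<le> \<psi> (exp s)" "\<psi> (exp s) \<le> 1" for s
    using acceptance_pos[OF \<psi>, of s] acceptance_le_1[OF \<psi>, of s] by simp_all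
  have "(\<Sum>z\<in>UNIV - {x}. K x z * \<psi> (exp (- b * (U z - U x)))) \<le> (\<Sum>z\<in>UNIV - {x}. K x z)"
    using acc markov_matrix_nonneg[OF K] by (intro sum_mono mult_left_le) auto
  also have "\<dots> \<le> (\<Sum>z\<in>UNIV. K x z)"
    using markov_matrix_nonneg[OF K] by (intro sum_mono2) auto
  finally have "(\<Sum>z\<in>UNIV - {x}. K x z * \<psi> (exp (- b * (U z - U x)))) \<le> 1"
    by (simp add: markov_matrix_row_sum[OF K])
  then show "0 \<le> annealed_matrix K U \<psi> b x y"
    using acc markov_matrix_nonneg[OF K] by (auto simp: annealed_matrix_def)
  have "(\<Sum>y\<in>UNIV. annealed_matrix K U \<psi> b x y) =
      annealed_matrix K U \<psi> b x x + (\<Sum>y\<in>UNIV - {x}. annealed_matrix K U \<psi> b x y)"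
    by (rule sum.remove) auto
  also have "(\<Sum>y\<in>UNIV - {x}. annealed_matrix K U \<psi> b x y) =
      (\<Sum>y\<in>UNIV - {x}. K x y * \<psi> (exp (- b * (U y - U x))))"
    by (intro sum.cong) (auto simp: annealed_off_diagonal)
  finally show "(\<Sum>y\<in>UNIV. annealed_matrix K U \<psi> b x y) = 1"
    by (simp add: annealed_matrix_def)
qed

lemma annealed_reversible:
  assumes p: "reversible_wrt K p" and \<psi>: "acceptance_function \<psi>"
  shows "reversible_wrt (annealed_matrix K U \<psi> b) (gibbs p U b)"
  unfolding reversible_wrt_def
proof (intro allI)
  fix x y
  show "gibbs p U b x * annealed_matrix K U \<psi> b x y = gibbs p U b y * annealed_matrix K U \<psi> b y x"
  proof (cases "x = y")
    case False
    have rev: "p x * K x y = p y * K y x" using p by (simp add: reversible_wrt_def)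
    have "\<psi> (exp (- b * (U y - U x))) = exp (- b * (U y - U x)) * \<psi> (exp (- (- b * (U y - U x))))"
      by (rule acceptance_balance[OF \<psi>])
    also have "- (- b * (U y - U x)) = - b * (U x - U y)" by (simp add: algebra_simps)
    finally have "exp (- (b * U x)) * \<psi> (exp (- b * (U y - U x))) =
        (exp (- (b * U x)) * exp (- b * (U y - U x))) * \<psi> (exp (- b * (U x - U y)))" by simp
    also have "exp (- (b * U x)) * exp (- b * (U y - U x)) = exp (- (b * U y))"
      unfolding exp_add[symmetric] by (simp add: algebra_simps)
    finally have "(p x * K x y) * (exp (- (b * U x)) * \<psi> (exp (- b * (U y - U x)))) =
        (p y * K y x) * (exp (- (b * U y)) * \<psi> (exp (- b * (U x - U y))))"
      by (simp add: rev)
    with False show ?thesis by (simp add: annealed_off_diagonal gibbs_def mult_ac)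
  qed simp
qed

text \<open>One constant for all \<open>b\<close> and \<open>b'\<close> is what makes the kernels of a slow cooling schedule change
  by at most a multiple of the increment of the schedule.\<close>

lemma annealed_lipschitz:
  assumes K: "markov_matrix K" and \<psi>: "acceptance_function \<psi>"
  obtains L where "0 \<le> L" "\<And>b b' x y.
    \<bar>annealed_matrix K U \<psi> b' x y - annealed_matrix K U \<psi> b x y\<bar> \<le> L * \<bar>b' - b\<bar>"
proof
  define L where "L = (\<Sum>x\<in>UNIV. \<Sum>y\<in>UNIV. \<bar>U y - U x\<bar>)"
  show "0 \<le> L" by (simp add: L_def sum_nonneg)
  fix b b' x y
  have row: "(\<Sum>z\<in>UNIV. \<bar>U z - U x\<bar>) \<le> L"
    unfolding L_def by (intro member_le_sum[where f="\<lambda>x. \<Sum>z\<in>UNIV. \<bar>U z - U x\<bar>"]) (auto intro!: sum_nonneg)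
  have K1: "K x z \<le> 1" for z
    using member_le_sum[of z UNIV "K x"] markov_matrix_nonneg[OF K] markov_matrix_row_sum[OF K, of x] by simp
  have entry: "\<bar>K x z * \<psi> (exp (- b' * (U z - U x))) - K x z * \<psi> (exp (- b * (U z - U x)))\<bar>
      \<le> \<bar>U z - U x\<bar> * \<bar>b' - b\<bar>" for z
  proof -
    have "\<bar>K x z * \<psi> (exp (- b' * (U z - U x))) - K x z * \<psi> (exp (- b * (U z - U x)))\<bar> =
        K x z * \<bar>\<psi> (exp (- b' * (U z - U x))) - \<psi> (exp (- b * (U z - U x)))\<bar>"
      using markov_matrix_nonneg[OF K] by (simp add: abs_mult flip: right_diff_distrib)
    also have "\<dots> \<le> 1 * \<bar>- b' * (U z - U x) - - b * (U z - U x)\<bar>"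
      using K1 markov_matrix_nonneg[OF K] by (intro mult_mono acceptance_lipschitz[OF \<psi>]) simp_all
    also have "\<bar>- b' * (U z - U x) - - b * (U z - U x)\<bar> = \<bar>U z - U x\<bar> * \<bar>b' - b\<bar>"
    proof -
      have "- b' * (U z - U x) - - b * (U z - U x) = - ((U z - U x) * (b' - b))"
        by (simp add: algebra_simps)
      then show ?thesis by (simp only: abs_minus_cancel abs_mult)
    qed
    finally show ?thesis by simp
  qed
  show "\<bar>annealed_matrix K U \<psi> b' x y - annealed_matrix K U \<psi> b x y\<bar> \<le> L * \<bar>b' - b\<bar>"
  proof (cases "x = y")
    case False
    have "\<bar>U y - U x\<bar> \<le> L"
      using row member_le_sum[of y UNIV "\<lambda>z. \<bar>U z - U x\<bar>"] by simp
    then have "\<bar>U y - U x\<bar> * \<bar>b' - b\<bar> \<le> L * \<bar>b' - b\<bar>" by (rule mult_right_mono) simp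
    with False entry[of y] show ?thesis by (simp add: annealed_off_diagonal)
  next
    case True
    have "\<bar>annealed_matrix K U \<psi> b' x y - annealed_matrix K U \<psi> b x y\<bar> =
      \<bar>\<Sum>z\<in>UNIV - {x}. K x z * \<psi> (exp (- b' * (U z - U x))) - K x z * \<psi> (exp (- b * (U z - U x)))\<bar>"
      using True by (simp add: annealed_matrix_def sum_subtractf)
    also have "\<dots> \<le> (\<Sum>z\<in>UNIV - {x}. \<bar>U z - U x\<bar> * \<bar>b' - b\<bar>)"
      using entry by (intro order_trans[OF sum_abs] sum_mono)
    also have "\<dots> \<le> (\<Sum>z\<in>UNIV. \<bar>U z - U x\<bar> * \<bar>b' - b\<bar>)" by (intro sum_mono2) auto
    also have "\<dots> \<le> L * \<bar>b' - b\<bar>"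
      unfolding sum_distrib_right[symmetric] using row by (rule mult_right_mono) simp
    finally show ?thesis .
  qed
qed

lemma successively_exit:
  assumes "successively Q \<gamma>" "\<gamma> \<noteq> []" "hd \<gamma> \<in> S" "last \<gamma> \<notin> S"
  obtains u v where "u \<in> set \<gamma>" "v \<in> set \<gamma>" "u \<in> S" "v \<notin> S" "Q u v"
  using assms
proof (induction \<gamma> arbitrary: thesis rule: induct_list012)
  case (3 x y zs)
  show ?case
  proof (cases "y \<in> S")
    case True
    show ?thesis
      by (rule "3.IH"(2)) (use "3.prems" True in \<open>auto simp: successively_Cons\<close>)
  next
    case False
    with "3.prems" show ?thesis by auto
  qed
qed auto

text \<open>Detailed balance propagates positivity of \<open>p\<close> along an edge, hence along a path.\<close>

lemma irreducible_positive:
  assumes K: "markov_matrix K" "irreducible_matrix K" and p: "prob_vector p" "reversible_wrt K p"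
  shows "0 < p x"
proof (rule ccontr)
  assume *: "\<not> 0 < p x"
  have nonneg: "0 \<le> p y" for y using p by (simp add: prob_vector_def)
  have "\<exists>y. 0 < p y"
  proof (rule ccontr)
    assume "\<not> ?thesis"
    then have "p y = 0" for y using nonneg[of y] by (auto simp: not_less intro: antisym)
    then show False using p by (simp add: prob_vector_def)
  qed
  then obtain y where y: "0 < p y" ..
  obtain \<gamma> where \<gamma>: "\<gamma> \<in> paths K y x" using K unfolding irreducible_matrix_def by blast
  then have "successively (\<lambda>u v. 0 < K u v) \<gamma>" "\<gamma> \<noteq> []" "hd \<gamma> \<in> {z. 0 < p z}" "last \<gamma> \<notin> {z. 0 < p z}"
    using y * by (auto simp: paths_def)
  then obtain u v where "0 < p u" "\<not> 0 < p v" "0 < K u v"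
    by (rule successively_exit) auto
  moreover have "p u * K u v = p v * K v u" using p by (simp add: reversible_wrt_def)
  moreover have "p v = 0" using nonneg[of v] \<open>\<not> 0 < p v\<close> by simp
  ultimately show False by simp
qed

text \<open>For a global minimizer \<open>r\<close> the terms \<open>- U r\<close> and \<open>Min (range U)\<close> in the energy barrier cancel:
  from every \<open>y\<close> one reaches \<open>r\<close> without climbing more than the barrier above \<open>U y\<close>.\<close>

lemma low_path:
  assumes K: "irreducible_matrix K" and r: "r \<in> Argmin U"
  obtains \<gamma> where "\<gamma> \<in> paths K y r" "\<And>z. z \<in> set \<gamma> \<Longrightarrow> U z \<le> U y + energy_barrier K U"
proof -
  let ?H = "(\<lambda>\<gamma>. Max (U ` set \<gamma>)) ` paths K y r"
  have "?H \<subseteq> range U"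
  proof
    fix h assume "h \<in> ?H"
    then obtain \<gamma> where "\<gamma> \<in> paths K y r" and h: "h = Max (U ` set \<gamma>)" by auto
    then have "U ` set \<gamma> \<noteq> {}" by (auto simp: paths_def)
    then have "h \<in> U ` set \<gamma>" unfolding h by (intro Max_in) auto
    then show "h \<in> range U" by auto
  qed
  then have fin: "finite ?H" by (rule finite_subset) simp
  have "?H \<noteq> {}" using K by (simp add: irreducible_matrix_def)
  then have "elev K U y r \<in> ?H" unfolding elev_def by (intro Min_in fin)
  then obtain \<gamma> where \<gamma>: "\<gamma> \<in> paths K y r" "elev K U y r = Max (U ` set \<gamma>)" by auto
  have "Min (range U) = U r"
    using r by (intro Min_eqI) (auto simp: Argmin_def)
  moreover have "elev K U y r - U y - U r + Min (range U) \<le> energy_barrier K U"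
    unfolding energy_barrier_def by (intro Max_ge finite_imageI) auto
  ultimately have "Max (U ` set \<gamma>) \<le> U y + energy_barrier K U" using \<gamma> by simp
  then show thesis using \<gamma> by (intro that[of \<gamma>]) (auto intro: order_trans[OF Max_ge])
qed

text \<open>The mass of \<open>S\<close> is at most \<open>exp (- b U y)\<close>, where \<open>y\<close> is its lowest point. A lowest
  path from \<open>y\<close> to \<open>r\<close> leaves \<open>S\<close> through an edge whose endpoints have energy at most
  \<open>U y + energy_barrier K U\<close>, so that its conductance is at least of order
  \<open>exp (- b (U y + energy_barrier K U))\<close>. The ratio is independent of \<open>y\<close>.\<close>

lemma annealed_bottleneck:
  assumes K: "markov_matrix K" "irreducible_matrix K" and p: "prob_vector p" "reversible_wrt K p"
    and \<psi>: "acceptance_function \<psi>" and r: "r \<in> Argmin U"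
  obtains C where "0 < C" "\<And>b. 0 \<le> b \<Longrightarrow>
    bottleneck (annealed_matrix K U \<psi> b) (gibbs p U b) r (C * exp (b * energy_barrier K U))"
proof -
  let ?H = "energy_barrier K U"
  \<comment> \<open>a lower bound for the positive conductances of \<open>K\<close>; the inserted \<open>1\<close> keeps the set nonempty\<close>
  define \<kappa> where "\<kappa> = Min (insert 1 {p u * K u v | u v. 0 < K u v})"
  have fin: "finite {p u * K u v | u v. 0 < K u v}"
    by (rule finite_subset[of _ "range (\<lambda>(u, v). p u * K u v)"]) auto
  have \<kappa>: "0 < \<kappa>" "0 < K u v \<Longrightarrow> \<kappa> \<le> p u * K u v" for u v
    unfolding \<kappa>_def using fin irreducible_positive[OF K p] by (auto intro!: Min_le)
  have "bottleneck (annealed_matrix K U \<psi> b) (gibbs p U b) r (2 / \<kappa> * exp (b * ?H))"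
    if b: "0 \<le> b" for b
    unfolding bottleneck_def
  proof (intro conjI allI impI)
    show "0 \<le> 2 / \<kappa> * exp (b * ?H)" using \<kappa>(1) by simp
    fix S :: "'a set" assume S: "S \<noteq> {}" "r \<notin> S"
    obtain y where y: "y \<in> S" "\<And>x. x \<in> S \<Longrightarrow> U y \<le> U x"
      using ex_min_if_finite[of "U ` S"] S by (auto simp: not_less) 
    obtain \<gamma> where \<gamma>: "\<gamma> \<in> paths K y r" "\<And>z. z \<in> set \<gamma> \<Longrightarrow> U z \<le> U y + ?H"
      using low_path[OF K(2) r] by blast
    obtain u v where uv: "u \<in> set \<gamma>" "v \<in> set \<gamma>" "u \<in> S" "v \<notin> S" "0 < K u v"
      using \<gamma>(1) y(1) S(2) successively_exit[of "\<lambda>u v. 0 < K u v" \<gamma> S] unfolding paths_def by auto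
    have "exp (- (b * (U y + ?H))) \<le> min (exp (- (b * U u))) (exp (- (b * U v)))"
      using \<gamma>(2)[OF uv(1)] \<gamma>(2)[OF uv(2)] b by (auto intro: mult_left_mono)
    also have "\<dots> = exp (- (b * U u)) * min 1 (exp (- b * (U v - U u)))"
    proof -
      have "exp (- (b * U v)) = exp (- (b * U u)) * exp (- b * (U v - U u))"
        unfolding exp_add[symmetric] by (simp add: algebra_simps)
      then show ?thesis by (simp only:) (simp add: min_def)
    qed
    also have "\<dots> \<le> exp (- (b * U u)) * (2 * \<psi> (exp (- b * (U v - U u))))"
      by (intro mult_left_mono acceptance_lower[OF \<psi>]) simp
    finally have h: "exp (- (b * (U y + ?H))) \<le> 2 * exp (- (b * U u)) * \<psi> (exp (- b * (U v - U u)))"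
      by simp
    have "\<kappa> * exp (- (b * (U y + ?H))) \<le>
        (p u * K u v) * (2 * exp (- (b * U u)) * \<psi> (exp (- b * (U v - U u))))"
      using \<kappa>(1) \<kappa>(2)[OF uv(5)] h by (intro mult_mono) auto
    also have "\<dots> = 2 * (gibbs p U b u * annealed_matrix K U \<psi> b u v)"
      using uv by (subst annealed_off_diagonal) (auto simp: gibbs_def)
    finally have c: "\<kappa> * exp (- (b * (U y + ?H))) \<le> 2 * (gibbs p U b u * annealed_matrix K U \<psi> b u v)" .
    have "sum (gibbs p U b) S \<le> (\<Sum>x\<in>S. p x * exp (- (b * U y)))"
      unfolding gibbs_def using y b irreducible_positive[OF K p]
      by (intro sum_mono mult_left_mono) (auto intro: mult_left_mono less_imp_le)
    also have "\<dots> = sum p S * exp (- (b * U y))" by (simp add: sum_distrib_right)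
    also have "\<dots> \<le> sum p UNIV * exp (- (b * U y))"
      using p by (intro mult_right_mono sum_mono2) (auto simp: prob_vector_def)
    also have "\<dots> = 1 / \<kappa> * exp (b * ?H) * (\<kappa> * exp (- (b * (U y + ?H))))"
    proof -
      have "exp (- (b * U y)) = exp (b * ?H) * exp (- (b * (U y + ?H)))"
        unfolding exp_add[symmetric] by (simp add: algebra_simps)
      then show ?thesis using p \<kappa>(1) by (simp add: prob_vector_def)
    qed
    also have "\<dots> \<le> 1 / \<kappa> * exp (b * ?H) * (2 * (gibbs p U b u * annealed_matrix K U \<psi> b u v))"
      using c \<kappa>(1) by (intro mult_left_mono) auto
    finally have "sum (gibbs p U b) S \<le>
        2 / \<kappa> * exp (b * ?H) * (gibbs p U b u * annealed_matrix K U \<psi> b u v)" by (simp add: mult_ac)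
    moreover have "0 < gibbs p U b u * annealed_matrix K U \<psi> b u v"
      using c \<kappa>(1) by (smt (verit) exp_gt_zero mult_pos_pos)
    ultimately show "\<exists>u\<in>S. \<exists>v\<in>-S. 0 < gibbs p U b u * annealed_matrix K U \<psi> b u v \<and>
        sum (gibbs p U b) S \<le> 2 / \<kappa> * exp (b * ?H) * (gibbs p U b u * annealed_matrix K U \<psi> b u v)"
      using uv by blast
  qed
  then show thesis using \<kappa>(1) by (intro that[of "2 / \<kappa>"]) auto
qed

lemma Argmin_nonempty:
  fixes U :: "'e::finite \<Rightarrow> real"
  obtains r where "r \<in> Argmin U"
  using ex_min_if_finite[of "range U"] by (auto simp: Argmin_def not_less)

lemma argmin_mass_pos:
  fixes p :: "'e::finite \<Rightarrow> real"
  assumes p: "\<And>x. 0 < p x"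
  shows "0 < (\<Sum>z\<in>UNIV. p z * indicator (Argmin U) z)"
proof -
  obtain r where r: "r \<in> Argmin U" by (rule Argmin_nonempty)
  have "0 < p r * indicator (Argmin U) r" using r p by simp
  also have "\<dots> \<le> (\<Sum>z\<in>UNIV. p z * indicator (Argmin U) z)"
    using p by (intro member_le_sum[where f="\<lambda>z. p z * indicator (Argmin U) z"])
      (auto simp: less_imp_le indicator_def)
  finally show ?thesis .
qed

text \<open>Shifting the energy by its minimum does not change the normalized weights and gives each
  single weight a limit: \<open>p x\<close> on the minimizers, \<open>0\<close> elsewhere.\<close>

lemma gibbs_tendsto_argmin_law:
  assumes p: "\<And>x. 0 < p x" and b: "filterlim b at_top sequentially"
  shows "(\<lambda>n. gibbs p U (b n) x / sum (gibbs p U (b n)) UNIV) \<longlonglongrightarrow> argmin_law p U x"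
proof -
  obtain r where r: "r \<in> Argmin U" by (rule Argmin_nonempty)
  define q where "q n x = p x * exp (- (b n * (U x - U r)))" for n x
  have q: "(\<lambda>n. q n x) \<longlonglongrightarrow> p x * indicator (Argmin U) x" for x
  proof (cases "x \<in> Argmin U")
    case True
    then have "U x = U r" using r by (auto simp: Argmin_def intro: antisym)
    then show ?thesis using True by (simp add: q_def)
  next
    case False
    then obtain y where "U y < U x" by (auto simp: Argmin_def not_le)
    moreover have "U r \<le> U y" using r by (simp add: Argmin_def)
    ultimately have pos: "0 < U x - U r" by simp
    have "filterlim (\<lambda>n. b n * (U x - U r)) at_top sequentially"
      by (rule filterlim_at_top_mult_tendsto_pos[OF tendsto_const pos b])
    then have "(\<lambda>n. exp (- (b n * (U x - U r)))) \<longlonglongrightarrow> 0"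
      by (intro filterlim_compose[OF exp_at_bot]) (simp add: filterlim_uminus_at_top)
    from tendsto_mult_left[OF this, of "p x"] False show ?thesis by (simp add: q_def)
  qed
  have "(\<Sum>z\<in>UNIV. p z * indicator (Argmin U) z) \<noteq> 0"
    using argmin_mass_pos[OF p] by (rule less_imp_neq[symmetric])
  then have "(\<lambda>n. q n x / (\<Sum>z\<in>UNIV. q n z)) \<longlonglongrightarrow> argmin_law p U x"
    unfolding argmin_law_def by (intro tendsto_divide tendsto_sum q)
  moreover have "gibbs p U (b n) x / sum (gibbs p U (b n)) UNIV = q n x / (\<Sum>z\<in>UNIV. q n z)" for n
  proof -
    have "q n z = exp (b n * U r) * gibbs p U (b n) z" for z
    proof -
      have "exp (- (b n * (U z - U r))) = exp (b n * U r) * exp (- (b n * U z))"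
        unfolding exp_add[symmetric] by (simp add: algebra_simps)
      then show ?thesis by (simp add: q_def gibbs_def)
    qed
    then show ?thesis by (simp flip: sum_distrib_left)
  qed
  ultimately show ?thesis by simp
qed

lemma argmin_law_prob_vector:
  assumes p: "\<And>x. 0 < p x"
  shows "prob_vector (argmin_law p U)"
  using argmin_mass_pos[of p U, OF p] p unfolding prob_vector_def argmin_law_def
  by (auto simp: less_imp_le sum_nonneg simp flip: sum_divide_distrib)

section \<open>Martingale increments along the chain\<close>

lemma chain_increment_orthogonal:
  fixes X :: "nat \<Rightarrow> 'w \<Rightarrow> 'e::finite"
  assumes P: "prob_space P" and X: "inhomogeneous_chain P F X K"
    and h: "h \<in> borel_measurable (F n)" "\<And>w. \<bar>h w\<bar> \<le> B"
  shows "(\<integral>w. h w * (g (X (Suc n) w) - (\<Sum>y\<in>UNIV. K n (X n w) y * g y)) \<partial>P) = 0"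
proof -
  interpret prob_space P by fact
  have sub: "subalgebra P (F k)" and XF: "X k \<in> measurable (F k) (count_space UNIV)" for k
    using X by (auto simp: inhomogeneous_chain_def)
  have cond: "AE w in P. real_cond_exp P (F n) (\<lambda>w. indicator {y} (X (Suc n) w)) w = K n (X n w) y" for y
    using X by (auto simp: inhomogeneous_chain_def)
  interpret finite_measure_subalgebra P "F n"
    by unfold_locales (rule sub)
  have XM [measurable]: "X k \<in> measurable P (count_space UNIV)" for k
    using measurable_from_subalg[OF sub XF] .
  have hM [measurable]: "h \<in> borel_measurable P"
    using measurable_from_subalg[OF sub h(1)] .
  have comp [measurable]: "(\<lambda>w. q (X k w)) \<in> borel_measurable P" for q :: "'e \<Rightarrow> real" and k
    by measurable
  have int: "integrable P (\<lambda>w. h w * q (X k w))" for q :: "'e \<Rightarrow> real" and k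
  proof (rule integrable_const_bound[of _ "B * (\<Sum>y\<in>UNIV. \<bar>q y\<bar>)"])
    have "\<bar>q y\<bar> \<le> (\<Sum>y\<in>UNIV. \<bar>q y\<bar>)" for y
      by (rule member_le_sum[where f="\<lambda>y. \<bar>q y\<bar>"]) auto
    then show "AE w in P. norm (h w * q (X k w)) \<le> B * (\<Sum>y\<in>UNIV. \<bar>q y\<bar>)"
      using h(2) by (intro always_eventually allI) (auto simp: abs_mult intro!: mult_mono order_trans[OF abs_ge_zero h(2)])
  qed measurable
  have step: "(\<integral>w. h w * indicator {y} (X (Suc n) w) \<partial>P) = (\<integral>w. h w * K n (X n w) y \<partial>P)" for y
  proof -
    have "(\<integral>w. h w * indicator {y} (X (Suc n) w) \<partial>P) =
        (\<integral>w. h w * real_cond_exp P (F n) (\<lambda>w. indicator {y} (X (Suc n) w)) w \<partial>P)"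
      by (intro real_cond_exp_intg(2)[symmetric] int h(1) comp)
    also have "\<dots> = (\<integral>w. h w * K n (X n w) y \<partial>P)"
      using cond[of y] by (intro integral_cong_AE) auto
    finally show ?thesis .
  qed
  have expand: "h w * (g (X (Suc n) w) - (\<Sum>y\<in>UNIV. K n (X n w) y * g y)) =
      (\<Sum>y\<in>UNIV. g y * (h w * indicator {y} (X (Suc n) w)) - g y * (h w * K n (X n w) y))" for w
  proof -
    have "g x = (\<Sum>y\<in>UNIV. g y * indicator {y} x)" for x
      by (simp add: indicator_def)
    then have "h w * g (X (Suc n) w) = h w * (\<Sum>y\<in>UNIV. g y * indicator {y} (X (Suc n) w))"
      by (rule arg_cong)
    also have "\<dots> = (\<Sum>y\<in>UNIV. g y * (h w * indicator {y} (X (Suc n) w)))"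
      by (simp only: sum_distrib_left mult.left_commute)
    finally show ?thesis
      by (simp add: sum_subtractf sum_distrib_left right_diff_distrib mult_ac)
  qed
  show ?thesis
    unfolding expand
    using int[of "indicator {y}" "Suc n" for y] int[of "\<lambda>x. K n x y" n for y] step
    by (subst Bochner_Integration.integral_sum) (auto simp: Bochner_Integration.integral_diff)
qed

lemma (in prob_space) integrable_bounded:
  fixes f :: "'a \<Rightarrow> real"
  assumes "f \<in> borel_measurable M" "\<And>w. \<bar>f w\<bar> \<le> B"
  shows "integrable M f"
  using assms by (intro integrable_const_bound[of _ B]) auto

text \<open>The sum starts at \<open>i = 1\<close> because bounds by a power of \<open>i\<close> are available from there on.\<close>

definition increment_sum ::
  "(nat \<Rightarrow> 'w \<Rightarrow> 'e::finite) \<Rightarrow> (nat \<Rightarrow> 'e \<Rightarrow> 'e \<Rightarrow> real) \<Rightarrow> (nat \<Rightarrow> 'e \<Rightarrow> real) \<Rightarrow> nat \<Rightarrow> 'w \<Rightarrow> real" where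
  "increment_sum X K g n w =
    (\<Sum>i=1..n. g i (X (Suc i) w) - (\<Sum>y\<in>UNIV. K i (X i w) y * g i y))"

lemma increment_sum_Suc:
  "increment_sum X K g (Suc n) w = increment_sum X K g n w +
    (g (Suc n) (X (Suc (Suc n)) w) - (\<Sum>y\<in>UNIV. K (Suc n) (X (Suc n) w) y * g (Suc n) y))"
  by (simp add: increment_sum_def)

text \<open>Each new increment is orthogonal to the past sum, so second moments add up. The first two
  claims are what is needed for the orthogonality and for integrability.\<close>

lemma increment_sum_second_moment:
  fixes X :: "nat \<Rightarrow> 'w \<Rightarrow> 'e::finite"
  assumes P: "prob_space P" and X: "inhomogeneous_chain P F X K"
    and K: "\<And>n. markov_matrix (K n)"
    and g: "\<And>i x. 1 \<le> i \<Longrightarrow> \<bar>g i x\<bar> \<le> G i"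
  shows "increment_sum X K g n \<in> borel_measurable (F (Suc n))"
    and "\<And>w. \<bar>increment_sum X K g n w\<bar> \<le> (\<Sum>i=1..n. 2 * G i)"
    and "(\<integral>w. (increment_sum X K g n w)\<^sup>2 \<partial>P) \<le> (\<Sum>i=1..n. (2 * G i)\<^sup>2)"
proof -
  interpret prob_space P by fact
  define D where "D i w = g i (X (Suc i) w) - (\<Sum>y\<in>UNIV. K i (X i w) y * g i y)" for i w
  have S: "increment_sum X K g n w = (\<Sum>i=1..n. D i w)" for n w
    by (simp add: increment_sum_def D_def)
  have filt: "filtration (space P) F" and sub: "subalgebra P (F k)"
    and XF: "X k \<in> measurable (F k) (count_space UNIV)" for k
    using X by (auto simp: inhomogeneous_chain_def)
  have mono: "q \<in> borel_measurable (F k) \<Longrightarrow> k \<le> l \<Longrightarrow> q \<in> borel_measurable (F l)"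
    for q :: "'w \<Rightarrow> real" and k l
    using filtration.sets_F_mono[OF filt, of k l] filtration.space_F[OF filt]
    by (auto simp: measurable_def)
  have comp: "(\<lambda>w. q (X k w)) \<in> borel_measurable (F k)" for q :: "'e \<Rightarrow> real" and k
    using XF by (rule measurable_compose) simp
  have D_meas: "D i \<in> borel_measurable (F (Suc i))" for i
    unfolding D_def
    using comp[of "g i" "Suc i"] mono[OF comp[of "\<lambda>x. \<Sum>y\<in>UNIV. K i x y * g i y" i], of "Suc i"]
    by (intro borel_measurable_diff) auto
  have D_bound: "\<bar>D i w\<bar> \<le> 2 * G i" if "1 \<le> i" for i w
  proof -
    have "\<bar>\<Sum>y\<in>UNIV. K i (X i w) y * g i y\<bar> \<le> (\<Sum>y\<in>UNIV. K i (X i w) y * G i)"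
      using g[OF that] markov_matrix_nonneg[OF K]
      by (intro order_trans[OF sum_abs] sum_mono) (auto simp: abs_mult intro!: mult_left_mono)
    also have "\<dots> = G i" by (simp add: markov_matrix_row_sum[OF K] flip: sum_distrib_right)
    finally show ?thesis using g[OF that, of "X (Suc i) w"] unfolding D_def by linarith
  qed
  have S_meas: "increment_sum X K g n \<in> borel_measurable (F (Suc n))" for n
    unfolding S by (intro borel_measurable_sum mono[OF D_meas]) auto
  then show "increment_sum X K g n \<in> borel_measurable (F (Suc n))" .
  have S_bound: "\<bar>increment_sum X K g n w\<bar> \<le> (\<Sum>i=1..n. 2 * G i)" for n w
    unfolding S using D_bound by (intro order_trans[OF sum_abs] sum_mono) auto
  then show "\<And>w. \<bar>increment_sum X K g n w\<bar> \<le> (\<Sum>i=1..n. 2 * G i)" .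
  note M = measurable_from_subalg[OF sub]
  have [measurable]: "D i \<in> borel_measurable P" "increment_sum X K g i \<in> borel_measurable P" for i
    using M[OF D_meas] M[OF S_meas] by auto
  show "(\<integral>w. (increment_sum X K g n w)\<^sup>2 \<partial>P) \<le> (\<Sum>i=1..n. (2 * G i)\<^sup>2)"
  proof (induction n)
    case 0
    then show ?case by (simp add: increment_sum_def)
  next
    case (Suc n)
    have D2: "(D (Suc n) w)\<^sup>2 \<le> (2 * G (Suc n))\<^sup>2" for w
      using power_mono[OF D_bound[of "Suc n" w], of 2] by simp
    have S2: "\<bar>(increment_sum X K g n w)\<^sup>2\<bar> \<le> (\<Sum>i=1..n. 2 * G i)\<^sup>2" for w
      using power_mono[OF S_bound[of n w], of 2] by simp
    have i1: "integrable P (\<lambda>w. (increment_sum X K g n w)\<^sup>2)"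
      using S2 by (intro integrable_bounded) measurable
    have i2: "integrable P (\<lambda>w. (D (Suc n) w)\<^sup>2)"
    proof (rule integrable_bounded[of _ "(2 * G (Suc n))\<^sup>2"])
      show "\<bar>(D (Suc n) w)\<^sup>2\<bar> \<le> (2 * G (Suc n))\<^sup>2" for w using D2[of w] by simp
    qed measurable
    have i3: "integrable P (\<lambda>w. increment_sum X K g n w * D (Suc n) w)"
    proof (rule integrable_bounded[of _ "(\<Sum>i=1..n. 2 * G i) * (2 * G (Suc n))"])
      show "\<bar>increment_sum X K g n w * D (Suc n) w\<bar> \<le> (\<Sum>i=1..n. 2 * G i) * (2 * G (Suc n))" for w
        unfolding abs_mult using S_bound[of n w] D_bound[of "Suc n" w]
        by (intro mult_mono) auto
    qed measurable
    have orth: "(\<integral>w. increment_sum X K g n w * D (Suc n) w \<partial>P) = 0"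
      unfolding D_def by (rule chain_increment_orthogonal[OF P X S_meas S_bound])
    have "(\<integral>w. (increment_sum X K g (Suc n) w)\<^sup>2 \<partial>P) =
        (\<integral>w. (increment_sum X K g n w)\<^sup>2 + 2 * (increment_sum X K g n w * D (Suc n) w) + (D (Suc n) w)\<^sup>2 \<partial>P)"
    proof -
      have "increment_sum X K g (Suc n) w = increment_sum X K g n w + D (Suc n) w" for w
        by (simp add: increment_sum_Suc D_def)
      then show ?thesis by (simp only: power2_sum) (simp add: algebra_simps)
    qed
    also have "\<dots> = (\<integral>w. (increment_sum X K g n w)\<^sup>2 \<partial>P) + (\<integral>w. (D (Suc n) w)\<^sup>2 \<partial>P)"
      using i1 i2 i3 orth by simp
    also have "(\<integral>w. (D (Suc n) w)\<^sup>2 \<partial>P) \<le> (\<integral>w. (2 * G (Suc n))\<^sup>2 \<partial>P)"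
      using i2 D2 by (intro integral_mono) auto
    finally show ?case using Suc.IH by (simp add: prob_space)
  qed
qed

text \<open>The expectation of \<open>\<Sum>k. (R k)\<^sup>2\<close> is finite, so the series converges almost surely.\<close>

lemma AE_tendsto_0_of_second_moments:
  fixes R :: "nat \<Rightarrow> 'w \<Rightarrow> real"
  assumes P: "prob_space P" and [measurable]: "\<And>k. R k \<in> borel_measurable P"
    and bd: "\<And>k w. \<bar>R k w\<bar> \<le> B k"
    and m2: "\<And>k. (\<integral>w. (R k w)\<^sup>2 \<partial>P) \<le> c k" and c: "summable c"
  shows "AE w in P. (\<lambda>k. R k w) \<longlonglongrightarrow> 0"
proof -
  interpret prob_space P by fact
  have int: "integrable P (\<lambda>w. (R k w)\<^sup>2)" for k
  proof (rule integrable_bounded[of _ "(B k)\<^sup>2"])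
    show "\<bar>(R k w)\<^sup>2\<bar> \<le> (B k)\<^sup>2" for w
      using power_mono[OF bd[of k w], of 2] by simp
  qed measurable
  have c0: "0 \<le> c k" for k using m2[of k] by (rule order_trans[rotated]) simp
  have "(\<integral>\<^sup>+w. (\<Sum>k. ennreal ((R k w)\<^sup>2)) \<partial>P) = (\<Sum>k. \<integral>\<^sup>+w. ennreal ((R k w)\<^sup>2) \<partial>P)"
    by (rule nn_integral_suminf) measurable
  also have "\<dots> = (\<Sum>k. ennreal (\<integral>w. (R k w)\<^sup>2 \<partial>P))"
    using int by (simp add: nn_integral_eq_integral)
  also have "\<dots> \<le> (\<Sum>k. ennreal (c k))"
    using m2 by (intro suminf_le ennreal_leI) auto
  also have "\<dots> = ennreal (\<Sum>k. c k)"
    using c0 c by (rule suminf_ennreal2)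
  also have "\<dots> < \<infinity>" by simp
  finally have "AE w in P. (\<Sum>k. ennreal ((R k w)\<^sup>2)) \<noteq> \<infinity>"
    by (intro nn_integral_PInf_AE) auto
  then show ?thesis
  proof (rule AE_mp, intro AE_I2 impI)
    fix w assume "(\<Sum>k. ennreal ((R k w)\<^sup>2)) \<noteq> \<infinity>"
    then have "summable (\<lambda>k. (R k w)\<^sup>2)"
      by (intro summable_suminf_not_top) (auto simp: top_unique)
    then have "(\<lambda>k. (R k w)\<^sup>2) \<longlonglongrightarrow> 0" by (rule summable_LIMSEQ_zero)
    then have "(\<lambda>k. sqrt ((R k w)\<^sup>2)) \<longlonglongrightarrow> sqrt 0" by (rule tendsto_real_sqrt)
    then show "(\<lambda>k. R k w) \<longlonglongrightarrow> 0" by (simp add: tendsto_rabs_zero_iff)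
  qed
qed

section \<open>From a power subsequence to the full sequence\<close>

lemma cesaro_tendsto_0:
  fixes a :: "nat \<Rightarrow> real"
  assumes "a \<longlonglongrightarrow> 0"
  shows "(\<lambda>n. (\<Sum>i=1..n. a i) / real n) \<longlonglongrightarrow> 0"
proof (rule LIMSEQ_I)
  fix e :: real assume e: "0 < e"
  obtain N where N: "\<And>i. N \<le> i \<Longrightarrow> \<bar>a i\<bar> < e / 2"
    using LIMSEQ_D[OF assms, of "e / 2"] e by auto
  define C where "C = (\<Sum>i\<le>N. \<bar>a i\<bar>)"
  have C: "0 \<le> C" by (simp add: C_def sum_nonneg)
  obtain M where M: "2 * C / e < real M" using reals_Archimedean2 by blast
  have "\<bar>(\<Sum>i=1..n. a i) / real n\<bar> < e" if n: "M \<le> n" "1 \<le> n" for n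
  proof -
    have "\<bar>\<Sum>i=1..n. a i\<bar> \<le> (\<Sum>i=1..n. (if i \<le> N then \<bar>a i\<bar> else 0) + e / 2)"
      using N e by (intro order_trans[OF sum_abs] sum_mono) (auto intro: less_imp_le)
    also have "\<dots> = (\<Sum>i\<in>{1..n} \<inter> {..N}. \<bar>a i\<bar>) + real n * (e / 2)"
    proof -
      have "(\<Sum>i=1..n. if i \<le> N then \<bar>a i\<bar> else 0) = (\<Sum>i\<in>{1..n} \<inter> {..N}. \<bar>a i\<bar>)"
        by (subst sum.inter_restrict) (simp_all only: atMost_iff finite_atLeastAtMost)
      then show ?thesis by (simp add: sum.distrib)
    qed
    also have "(\<Sum>i\<in>{1..n} \<inter> {..N}. \<bar>a i\<bar>) \<le> C"
      unfolding C_def by (intro sum_mono2) auto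
    also have "C < real n * (e / 2)"
    proof -
      have "2 * C / e < real n" using M n by linarith
      then show ?thesis using e by (simp add: field_simps)
    qed
    finally have "\<bar>\<Sum>i=1..n. a i\<bar> < real n * e" by (simp add: mult.commute)
    then show ?thesis using n by (simp add: pos_divide_less_eq mult.commute)
  qed
  then show "\<exists>M. \<forall>n\<ge>M. norm ((\<Sum>i=1..n. a i) / real n - 0) < e"
    by (intro exI[of _ "max M 1"]) auto
qed

text \<open>Since \<open>(k + 1)\<^sup>m / k\<^sup>m\<close> tends to \<open>1\<close>, the at most \<open>c ((k + 1)\<^sup>m - k\<^sup>m)\<close> by which \<open>s\<close> moves
  between two consecutive powers is negligible compared with \<open>k\<^sup>m\<close>.\<close>

lemma average_tendsto_0_from_powers:
  fixes s :: "nat \<Rightarrow> real"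
  assumes inc: "\<And>n. \<bar>s (Suc n) - s n\<bar> \<le> c" and m: "1 \<le> m"
    and sub: "(\<lambda>k. s (Suc k ^ m) / real (Suc k ^ m)) \<longlonglongrightarrow> 0"
  shows "(\<lambda>n. s n / real n) \<longlonglongrightarrow> 0"
proof -
  \<comment> \<open>the integer part of the \<open>m\<close>-th root of \<open>n\<close>\<close>
  define q where "q n = (LEAST k. n < Suc k ^ m)" for n
  have ex: "n < Suc n ^ m" for n using m by (simp add: less_le_trans[OF lessI self_le_power])
  have q_upper: "n < Suc (q n) ^ m" for n
    unfolding q_def by (rule LeastI[of "\<lambda>k. n < Suc k ^ m", OF ex])
  have q_pos: "1 \<le> q n" if "1 \<le> n" for n
    using q_upper[of n] that by (cases "q n") auto
  have q_lower: "q n ^ m \<le> n" if n: "1 \<le> n" for n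
  proof -
    obtain k where k: "q n = Suc k" using q_pos[OF n] by (cases "q n") auto
    then show ?thesis using not_less_Least[of k "\<lambda>k. n < Suc k ^ m"] by (simp add: q_def not_less)
  qed
  have q_top: "filterlim q at_top sequentially"
    unfolding filterlim_at_top
  proof
    fix Z
    show "\<forall>\<^sub>F n in sequentially. Z \<le> q n"
    proof (rule eventually_sequentiallyI[of "Z ^ m"])
      fix n assume n: "Z ^ m \<le> n"
      show "Z \<le> q n"
      proof (rule ccontr)
        assume "\<not> Z \<le> q n"
        then have "Suc (q n) ^ m \<le> Z ^ m" by (intro power_mono) auto
        with n q_upper[of n] show False by linarith
      qed
    qed
  qed
  have drift: "\<bar>s n - s l\<bar> \<le> c * real (n - l)" if "l \<le> n" for l n
    using that
  proof (induction n rule: dec_induct)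
    case (step n)
    then show ?case using inc[of n] by (simp add: Suc_diff_le algebra_simps)
  qed simp
  have c: "0 \<le> c" using inc[of 0] by linarith
  define e where "e k = \<bar>s (k ^ m)\<bar> / real (k ^ m) + c * ((real (Suc k) / real k) ^ m - 1)" for k
  have "(\<lambda>k. s (k ^ m) / real (k ^ m)) \<longlonglongrightarrow> 0"
    by (rule LIMSEQ_imp_Suc) (rule sub)
  from tendsto_rabs_zero[OF this] have "(\<lambda>k. \<bar>s (k ^ m)\<bar> / real (k ^ m)) \<longlonglongrightarrow> 0"
    by (simp add: power_abs)
  moreover have "(\<lambda>k. real (Suc k) / real k) \<longlonglongrightarrow> 1" by real_asymp
  ultimately have "e \<longlonglongrightarrow> 0 + c * (1 ^ m - 1)"
    unfolding e_def by (intro tendsto_intros)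
  then have "(\<lambda>n. e (q n)) \<longlonglongrightarrow> 0"
    using filterlim_compose[OF _ q_top] by simp
  moreover have "\<forall>\<^sub>F n in sequentially. norm (s n / real n) \<le> e (q n)"
  proof (rule eventually_sequentiallyI[of 1])
    fix n :: nat assume n: "1 \<le> n"
    have qm: "0 < real (q n ^ m)" using q_pos[OF n] by simp
    have "\<bar>s n\<bar> \<le> \<bar>s (q n ^ m)\<bar> + c * real (n - q n ^ m)"
      using drift[OF q_lower[OF n]] by linarith
    also have "\<dots> \<le> \<bar>s (q n ^ m)\<bar> + c * (real (Suc (q n) ^ m) - real (q n ^ m))"
      using q_lower[OF n] q_upper[of n] c by (intro add_left_mono mult_left_mono) (auto simp: of_nat_diff simp del: of_nat_power)
    finally have "\<bar>s n\<bar> / real n \<le>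
        (\<bar>s (q n ^ m)\<bar> + c * (real (Suc (q n) ^ m) - real (q n ^ m))) / real (q n ^ m)"
      using q_lower[OF n] qm by (intro frac_le) (simp_all del: of_nat_power)
    also have "\<dots> = e (q n)"
    proof -
      have split: "(u + c * (v - x)) / x = u / x + c * (v / x - 1)" if "0 < x" for u v x
        using that by (simp add: field_simps)
      have "0 < real (q n) ^ m" using qm by simp
      then show ?thesis by (simp only: split e_def power_divide of_nat_power)
    qed
    finally show "norm (s n / real n) \<le> e (q n)" by simp
  qed
  ultimately show ?thesis by (rule Lim_null_comparison[rotated])
qed

section \<open>The law of large numbers for an additive functional\<close>

text \<open>The variance of the average over \<open>n\<close> steps is of order \<open>n\<close> to the power \<open>2 a - 1 < 0\<close>. This is
  summable only along a sufficiently sparse sequence such as \<open>n = (k + 1)\<^sup>m\<close> with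
  \<open>m (1 - 2 a) > 1\<close>.\<close>

lemma increment_sum_power_average:
  fixes X :: "nat \<Rightarrow> 'w \<Rightarrow> 'e::finite"
  assumes P: "prob_space P" and X: "inhomogeneous_chain P F X K"
    and K: "\<And>n. markov_matrix (K n)"
    and a: "0 \<le> a" "2 * a < 1"
    and g: "\<And>i x. 1 \<le> i \<Longrightarrow> \<bar>g i x\<bar> \<le> C * real i powr a"
  obtains m where "1 \<le> m"
    "AE w in P. (\<lambda>k. increment_sum X K g (Suc k ^ m) w / real (Suc k ^ m)) \<longlonglongrightarrow> 0"
proof -
  obtain m :: nat where m: "1 / (1 - 2 * a) < real m" using reals_Archimedean2 by blast
  have m1: "1 \<le> m" using m a by (cases m) (auto simp: field_simps)
  have exponent: "real m * (2 * a - 1) < - 1" using m a by (simp add: field_simps)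
  let ?G = "\<lambda>i. C * real i powr a"
  note moments = increment_sum_second_moment[OF P X K g]
  have sub: "subalgebra P (F k)" for k using X by (simp add: inhomogeneous_chain_def)
  have [measurable]: "increment_sum X K g n \<in> borel_measurable P" for n
    using measurable_from_subalg[OF sub moments(1)] by simp
  have "AE w in P. (\<lambda>k. increment_sum X K g (Suc k ^ m) w / real (Suc k ^ m)) \<longlonglongrightarrow> 0"
  proof (rule AE_tendsto_0_of_second_moments[OF P])
    show "(\<lambda>w. increment_sum X K g (Suc k ^ m) w / real (Suc k ^ m)) \<in> borel_measurable P" for k
      by measurable
    show "\<bar>increment_sum X K g (Suc k ^ m) w / real (Suc k ^ m)\<bar> \<le>
        (\<Sum>i=1..Suc k ^ m. 2 * ?G i) / real (Suc k ^ m)" for k w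
      unfolding abs_divide abs_of_nat by (rule divide_right_mono[OF moments(2) of_nat_0_le_iff])
    show "summable (\<lambda>k. 4 * C\<^sup>2 * real (Suc k) powr (real m * (2 * a - 1)))"
    proof (rule summable_mult)
      have "summable (\<lambda>k. real k powr (real m * (2 * a - 1)))"
        using exponent by (simp only: summable_real_powr_iff)
      then show "summable (\<lambda>k. real (Suc k) powr (real m * (2 * a - 1)))"
        by (rule summable_Suc_iff[THEN iffD2])
    qed
    fix k
    define n where "n = Suc k ^ m"
    have n: "0 < real n" by (simp add: n_def)
    have npow: "real n = real (Suc k) powr real m" by (simp add: n_def powr_realpow)
    have "(\<integral>w. (increment_sum X K g n w / real n)\<^sup>2 \<partial>P) =
        (\<integral>w. (increment_sum X K g n w)\<^sup>2 \<partial>P) / (real n)\<^sup>2"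
      by (simp add: power_divide)
    also have "\<dots> \<le> (\<Sum>i=1..n. (2 * ?G i)\<^sup>2) / (real n)\<^sup>2"
      by (rule divide_right_mono[OF moments(3) zero_le_power2])
    also have "(\<Sum>i=1..n. (2 * ?G i)\<^sup>2) \<le> (\<Sum>i=1..n. 4 * C\<^sup>2 * (real n powr a)\<^sup>2)"
      using a by (intro sum_mono) (auto simp: power_mult_distrib intro!: mult_left_mono power_mono powr_mono2)
    also have "\<dots> / (real n)\<^sup>2 = 4 * C\<^sup>2 * ((real n powr a)\<^sup>2 / real n)"
      using n by (simp add: power2_eq_square)
    also have "(real n powr a)\<^sup>2 / real n = real n powr (2 * a - 1)"
    proof -
      have "(real n powr a)\<^sup>2 = real n powr (2 * a)"
        by (simp add: power2_eq_square flip: powr_add)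
      then show ?thesis using n by (simp add: powr_diff)
    qed
    also have "\<dots> = real (Suc k) powr (real m * (2 * a - 1))"
      by (simp add: npow powr_powr)
    finally show "(\<integral>w. (increment_sum X K g (Suc k ^ m) w / real (Suc k ^ m))\<^sup>2 \<partial>P) \<le>
        4 * C\<^sup>2 * real (Suc k) powr (real m * (2 * a - 1))"
      using n by (simp add: n_def divide_right_mono)
  qed
  with m1 that show thesis by blast
qed

text \<open>Writing the summand as \<open>g i (X i) - (K i g i) (X i)\<close> and inserting \<open>g i (X (i + 1))\<close> gives a
  martingale increment; summation by parts of what remains leaves two boundary terms and the
  drift caused by the change of \<open>g i\<close> with \<open>i\<close>.\<close>

lemma poisson_decomposition:
  assumes "\<And>i x. 1 \<le> i \<Longrightarrow> laplacian (K i) (g i) x = f x - c i"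
  shows "(\<Sum>i=1..n. f (X i w) - c i) = increment_sum X K g n w +
    (g 1 (X 1 w) - g (Suc n) (X (Suc n) w)) +
    (\<Sum>i=1..n. g (Suc i) (X (Suc i) w) - g i (X (Suc i) w))"
proof (induction n)
  case 0
  then show ?case by (simp add: increment_sum_def)
next
  case (Suc n)
  have "f (X (Suc n) w) - c (Suc n) =
      g (Suc n) (X (Suc n) w) - (\<Sum>y\<in>UNIV. K (Suc n) (X (Suc n) w) y * g (Suc n) y)"
    using assms[of "Suc n" "X (Suc n) w"] by (simp add: laplacian_def)
  with Suc.IH show ?case by (simp add: increment_sum_Suc)
qed

text \<open>In the Poisson decomposition, divided by \<open>n\<close>, the boundary terms vanish because \<open>a < 1\<close> and the
  drift vanishes as a Cesaro mean of \<open>e\<close>, both for every sample path. The martingale part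
  vanishes along a power subsequence almost surely. Only the whole sum, not its martingale part,
  has bounded increments, so the interpolation between powers is done after adding the
  three parts.\<close>

lemma ergodic_average_tendsto:
  fixes X :: "nat \<Rightarrow> 'w \<Rightarrow> 'e::finite"
  assumes P: "prob_space P" and X: "inhomogeneous_chain P F X K"
    and K: "\<And>n. markov_matrix (K n)"
    and a: "0 \<le> a" "2 * a < 1"
    and g: "\<And>i x. 1 \<le> i \<Longrightarrow> \<bar>g i x\<bar> \<le> C * real i powr a"
    and poisson: "\<And>i x. 1 \<le> i \<Longrightarrow> laplacian (K i) (g i) x = f x - c i"
    and inc: "\<And>i x. 1 \<le> i \<Longrightarrow> \<bar>g (Suc i) x - g i x\<bar> \<le> e i" "e \<longlonglongrightarrow> 0"
    and c: "c \<longlonglongrightarrow> l"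
  shows "AE w in P. (\<lambda>n. (\<Sum>i=1..n. f (X i w)) / real n) \<longlonglongrightarrow> l"
proof -
  obtain m where m: "1 \<le> m"
    and AE: "AE w in P. (\<lambda>k. increment_sum X K g (Suc k ^ m) w / real (Suc k ^ m)) \<longlonglongrightarrow> 0"
    by (rule increment_sum_power_average[OF P X K a g]) (assumption | rule that)+
  show ?thesis
    using AE
  proof eventually_elim
    case (elim w)
    define s where "s n = (\<Sum>i=1..n. f (X i w) - c i)" for n
    define r where "r n = s n - increment_sum X K g n w" for n
    have r_bound: "\<bar>r n\<bar> \<le> C + C * real (Suc n) powr a + (\<Sum>i=1..n. e i)" for n
    proof -
      have "\<bar>\<Sum>i=1..n. g (Suc i) (X (Suc i) w) - g i (X (Suc i) w)\<bar> \<le> (\<Sum>i=1..n. e i)"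
        using inc(1) by (intro order_trans[OF sum_abs] sum_mono) auto
      moreover have "\<bar>g 1 (X 1 w)\<bar> \<le> C" using g[of 1 "X 1 w"] by simp
      moreover have "\<bar>g (Suc n) (X (Suc n) w)\<bar> \<le> C * real (Suc n) powr a" by (rule g) simp
      moreover have "s n = increment_sum X K g n w + (g 1 (X 1 w) - g (Suc n) (X (Suc n) w)) +
          (\<Sum>i=1..n. g (Suc i) (X (Suc i) w) - g i (X (Suc i) w))"
        unfolding s_def by (rule poisson_decomposition) (rule poisson)
      ultimately show ?thesis unfolding r_def by linarith
    qed
    have lim: "(\<lambda>n. (C + C * real (Suc n) powr a + (\<Sum>i=1..n. e i)) / real n) \<longlonglongrightarrow> 0"
    proof -
      have "a < 1" using a by simp
      then have "(\<lambda>n. real (Suc n) powr a / real n) \<longlonglongrightarrow> 0" by real_asymp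
      from tendsto_add[OF lim_1_over_n this]
      have "(\<lambda>n. 1 / real n + real (Suc n) powr a / real n) \<longlonglongrightarrow> 0" by simp
      from tendsto_add[OF tendsto_mult_right_zero[OF this, of C] cesaro_tendsto_0[OF inc(2)]]
      show ?thesis by (simp add: add_divide_distrib distrib_left)
    qed
    have r: "(\<lambda>n. r n / real n) \<longlonglongrightarrow> 0"
    proof (rule Lim_null_comparison[OF always_eventually lim], rule allI)
      show "norm (r n / real n) \<le> (C + C * real (Suc n) powr a + (\<Sum>i=1..n. e i)) / real n" for n
        unfolding real_norm_def abs_divide abs_of_nat
        by (rule divide_right_mono[OF r_bound of_nat_0_le_iff])
    qed
    have power_top: "filterlim (\<lambda>k. Suc k ^ m) at_top sequentially"
      using m by (intro filterlim_at_top_mono[OF filterlim_Suc] always_eventually allI self_le_power) auto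
    have "(\<lambda>k. increment_sum X K g (Suc k ^ m) w / real (Suc k ^ m) + r (Suc k ^ m) / real (Suc k ^ m))
        \<longlonglongrightarrow> 0 + 0"
      by (intro tendsto_add elim filterlim_compose[OF r power_top])
    then have sub: "(\<lambda>k. s (Suc k ^ m) / real (Suc k ^ m)) \<longlonglongrightarrow> 0"
      by (simp add: r_def diff_divide_distrib)
    obtain B where B: "\<And>n. \<bar>c n\<bar> \<le> B"
      using convergent_imp_Bseq[OF convergentI[OF c]] by (auto simp: Bseq_def)
    have "\<bar>s (Suc n) - s n\<bar> \<le> (\<Sum>x\<in>UNIV. \<bar>f x\<bar>) + B" for n
    proof -
      have "\<bar>f (X (Suc n) w)\<bar> \<le> (\<Sum>x\<in>UNIV. \<bar>f x\<bar>)"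
        by (rule member_le_sum[where f="\<lambda>x. \<bar>f x\<bar>"]) auto
      then show ?thesis using B[of "Suc n"] by (simp add: s_def)
    qed
    from average_tendsto_0_from_powers[OF this m sub]
    have "(\<lambda>n. s n / real n) \<longlonglongrightarrow> 0" .
    moreover have "(\<lambda>n. (\<Sum>i=1..n. c i - l) / real n) \<longlonglongrightarrow> 0"
      using c by (intro cesaro_tendsto_0) (simp add: LIM_zero)
    ultimately have "(\<lambda>n. s n / real n + (\<Sum>i=1..n. c i - l) / real n + l) \<longlonglongrightarrow> 0 + 0 + l"
      by (intro tendsto_intros)
    then have "(\<lambda>n. s n / real n + (\<Sum>i=1..n. c i - l) / real n + l) \<longlonglongrightarrow> l" by simp
    moreover have "\<forall>\<^sub>F n in sequentially. s n / real n + (\<Sum>i=1..n. c i - l) / real n + l =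
        (\<Sum>i=1..n. f (X i w)) / real n"
      by (rule eventually_sequentiallyI[of 1]) (simp add: s_def sum_subtractf field_simps)
    ultimately show ?case by (rule Lim_transform_eventually)
  qed
qed

section \<open>Logarithmic cooling schedules\<close>

text \<open>Both \<open>\<beta>\<close> and \<open>A ln - \<beta>\<close> have a nonnegative derivative.\<close>

lemma log_growth:
  fixes \<beta> :: "real \<Rightarrow> real"
  assumes diff: "\<And>t. 0 < t \<Longrightarrow> \<beta> differentiable (at t)"
    and deriv: "\<And>t. 0 < t \<Longrightarrow> 0 \<le> deriv \<beta> t \<and> deriv \<beta> t \<le> A / t"
    and st: "0 < s" "s \<le> t"
  shows "\<beta> s \<le> \<beta> t" "\<beta> t - \<beta> s \<le> A * (ln t - ln s)"
proof -
  have D: "(\<beta> has_real_derivative deriv \<beta> u) (at u)" if "0 < u" for u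
    using diff[OF that] by (simp add: DERIV_deriv_iff_real_differentiable)
  show "\<beta> s \<le> \<beta> t"
  proof (rule DERIV_nonneg_imp_nondecreasing[OF st(2)])
    fix u assume "s \<le> u" "u \<le> t"
    then show "\<exists>y. (\<beta> has_real_derivative y) (at u) \<and> 0 \<le> y"
      using D[of u] deriv[of u] st by (intro exI[of _ "deriv \<beta> u"]) auto
  qed
  have "A * ln s - \<beta> s \<le> A * ln t - \<beta> t"
  proof (rule DERIV_nonneg_imp_nondecreasing[OF st(2)])
    fix u assume "s \<le> u" "u \<le> t"
    then have u: "0 < u" using st by simp
    have "((\<lambda>u. A * ln u - \<beta> u) has_real_derivative A / u - deriv \<beta> u) (at u)"
      using u by (auto intro!: derivative_eq_intros D)
    then show "\<exists>y. ((\<lambda>u. A * ln u - \<beta> u) has_real_derivative y) (at u) \<and> 0 \<le> y"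
      using deriv[OF u] by (intro exI conjI) auto
  qed
  then show "\<beta> t - \<beta> s \<le> A * (ln t - ln s)" by (simp add: algebra_simps)
qed

theorem proposition4p4:
  fixes M0 :: "'e::finite \<Rightarrow> 'e \<Rightarrow> real"
    and \<pi>0 U :: "'e \<Rightarrow> real"
    and \<psi> \<beta> :: "real \<Rightarrow> real"
    and \<beta>s :: "nat \<Rightarrow> real"
    and A :: real
    and P :: "'w measure"
    and F :: "nat \<Rightarrow> 'w measure"
    and X :: "nat \<Rightarrow> 'w \<Rightarrow> 'e"
  assumes M0: "markov_matrix M0" "irreducible_matrix M0"
    and \<pi>0: "prob_vector \<pi>0" "reversible_wrt M0 \<pi>0"
    and \<psi>: "\<psi> = (\<lambda>u. min 1 u) \<or> \<psi> = (\<lambda>u. u / (1 + u))"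
    and \<beta>s_pos: "\<And>n. 0 < \<beta>s n"
    and P: "prob_space P"
    and X: "inhomogeneous_chain P F X (\<lambda>n. annealed_matrix M0 U \<psi> (\<beta>s n))"
    and \<beta>s: "\<And>n. \<beta>s n = \<beta> (real n)"
    and rare: "filterlim \<beta>s at_top sequentially"
    and \<beta>_nonneg: "\<And>t. 0 \<le> t \<Longrightarrow> 0 \<le> \<beta> t"
    and \<beta>_diff: "\<And>t. 0 < t \<Longrightarrow> \<beta> differentiable (at t)"
    and \<beta>_deriv: "\<And>t. 0 < t \<Longrightarrow> 0 \<le> deriv \<beta> t \<and> deriv \<beta> t \<le> A / t"
    and A: "ereal A < 1 / ereal (2 * energy_barrier M0 U)"
  shows "prob_vector (argmin_law \<pi>0 U) \<and>
    (AE w in P. \<forall>x. (\<lambda>n. empirical_occupation X n w x) \<longlonglongrightarrow> argmin_law \<pi>0 U x)"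
proof
  have pos: "0 < \<pi>0 x" for x using irreducible_positive[OF M0 \<pi>0] .
  show "prob_vector (argmin_law \<pi>0 U)" using pos by (rule argmin_law_prob_vector)
  have acc: "acceptance_function \<psi>"
    using \<psi> metropolis_acceptance barker_acceptance by auto
  obtain r where r: "r \<in> Argmin U" by (rule Argmin_nonempty)
  define H where "H = energy_barrier M0 U"
  have A0: "0 \<le> A" using \<beta>_deriv[of 1] by simp
  have H0: "0 \<le> H"
  proof (rule ccontr)
    assume "\<not> 0 \<le> H"
    then have "A < 1 / (2 * H)" using A by (simp add: H_def one_ereal_def)
    moreover have "1 / (2 * H) < 0" using \<open>\<not> 0 \<le> H\<close> by simp
    ultimately show False using A0 by linarith
  qed
  \<comment> \<open>\<open>exp (\<beta> H)\<close> grows at most like the power \<open>a\<close> of time; the bound on \<open>A\<close> says \<open>2 * a < 1\<close>, also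
    when \<open>H = 0\<close>, where the right-hand side of that bound is infinite\<close>
  define a where "a = A * H"
  have a0: "0 \<le> a" using A0 H0 by (simp add: a_def)
  have a1: "2 * a < 1"
  proof (cases "H = 0")
    case False
    then have "A < 1 / (2 * H)" using A by (simp add: H_def one_ereal_def)
    with False H0 show ?thesis by (simp add: a_def field_simps)
  qed (simp add: a_def)
  define K where "K n = annealed_matrix M0 U \<psi> (\<beta>s n)" for n
  define m where "m n = gibbs \<pi>0 U (\<beta>s n)" for n
  have K: "markov_matrix (K n)" for n unfolding K_def by (rule annealed_markov[OF M0(1) acc])
  have rev: "reversible_wrt (K n) (m n)" for n
    unfolding K_def m_def by (rule annealed_reversible[OF \<pi>0(2) acc])
  have m_pos: "0 < m n x" for n x using pos by (simp add: m_def gibbs_def)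
  have m_sum: "0 < sum (m n) UNIV" for n using m_pos by (intro sum_pos) auto
  obtain C where C: "0 < C" and bottle: "\<And>b. 0 \<le> b \<Longrightarrow>
      bottleneck (annealed_matrix M0 U \<psi> b) (gibbs \<pi>0 U b) r (C * exp (b * H))"
    using annealed_bottleneck[OF M0 \<pi>0 acc r] unfolding H_def by metis
  define R where "R n = C * exp (\<beta>s n * H)" for n
  have R: "bottleneck (K n) (m n) r (R n)" for n
    unfolding K_def m_def R_def using \<beta>s_pos by (intro bottle less_imp_le)
  obtain L where L: "0 \<le> L" "\<And>b b' x y.
      \<bar>annealed_matrix M0 U \<psi> b' x y - annealed_matrix M0 U \<psi> b x y\<bar> \<le> L * \<bar>b' - b\<bar>"
    using annealed_lipschitz[OF M0(1) acc, of U] by metis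
  define C' where "C' = C * exp (\<beta>s 1 * H)"
  have C': "0 < C'" using C by (simp add: C'_def)
  have R_le: "R n \<le> C' * real n powr a" if n: "1 \<le> n" for n
  proof -
    have "\<beta>s n \<le> \<beta>s 1 + A * ln (real n)"
      using log_growth(2)[OF \<beta>_diff \<beta>_deriv, of 1 "real n"] n by (simp add: \<beta>s)
    then have "\<beta>s n * H \<le> (\<beta>s 1 + A * ln (real n)) * H" using H0 by (rule mult_right_mono)
    then have "exp (\<beta>s n * H) \<le> exp (\<beta>s 1 * H + a * ln (real n))"
      by (simp add: a_def algebra_simps)
    also have "\<dots> = exp (\<beta>s 1 * H) * real n powr a" using n by (simp add: exp_add powr_def)
    finally have "C * exp (\<beta>s n * H) \<le> C * (exp (\<beta>s 1 * H) * real n powr a)"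
      using C by (intro mult_left_mono) auto
    then show ?thesis by (simp add: R_def C'_def mult.assoc)
  qed
  have increment: "\<bar>\<beta>s (Suc n) - \<beta>s n\<bar> \<le> A / real n" if n: "1 \<le> n" for n
  proof -
    have "ln (real (Suc n)) - ln (real n) \<le> (real (Suc n) - real n) / real n"
      using n by (intro ln_diff_le) auto
    then have "A * (ln (real (Suc n)) - ln (real n)) \<le> A * (1 / real n)"
      using A0 by (intro mult_left_mono) auto
    moreover have "\<beta>s n \<le> \<beta>s (Suc n)" "\<beta>s (Suc n) - \<beta>s n \<le> A * (ln (real (Suc n)) - ln (real n))"
      unfolding \<beta>s using n by (intro log_growth[OF \<beta>_diff \<beta>_deriv]; simp)+
    ultimately show ?thesis by simp
  qed
  have "AE w in P. (\<lambda>n. (\<Sum>i=1..n. indicator {x} (X i w)) / real n) \<longlonglongrightarrow> argmin_law \<pi>0 U x" for x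
  proof -
    define f :: "'e \<Rightarrow> real" where "f = indicator {x}"
    define c where "c n = (\<Sum>y\<in>UNIV. m n y * f y) / sum (m n) UNIV" for n
    have c_eq: "c n = m n x / sum (m n) UNIV" for n
      by (simp add: c_def f_def indicator_def)
    have c_lim: "c \<longlonglongrightarrow> argmin_law \<pi>0 U x"
      unfolding c_eq m_def using gibbs_tendsto_argmin_law[OF pos rare] by simp
    have c_range: "0 \<le> c n \<and> c n \<le> 1" for n
      using m_pos[of n] m_sum[of n] member_le_sum[of x UNIV "m n"] by (simp add: c_eq less_imp_le)
    have centred: "\<bar>f y - c n\<bar> \<le> 1" for n y
      using c_range[of n] by (simp add: f_def indicator_def abs_le_iff)
    have "\<exists>g. g r = 0 \<and> (\<forall>y. laplacian (K n) g y = f y - c n)" for n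
      using poisson_solution[OF K rev less_imp_le[OF m_pos] R m_sum] unfolding c_def by metis
    then obtain g where g0: "\<And>n. g n r = 0" and g: "\<And>n y. laplacian (K n) (g n) y = f y - c n"
      by metis
    let ?N = "real CARD('e)"
    have g_bound: "\<bar>g n y\<bar> \<le> (?N * C') * real n powr a" if n: "1 \<le> n" for n y
    proof -
      have "\<bar>g n y - g n r\<bar> \<le> ?N * (R n * 1)"
        by (rule bottleneck_osc_bound[OF K rev less_imp_le[OF m_pos] R]) (simp add: g centred)
      also have "\<dots> \<le> ?N * (C' * real n powr a)"
        using R_le[OF n] by (intro mult_left_mono) auto
      finally show ?thesis by (simp add: g0 mult.assoc)
    qed
    \<comment> \<open>a bound for \<open>g\<close>, an amplification by the next bottleneck constant, and a kernel increment
      of order \<open>1 / n\<close>: in total the power \<open>2 * a - 1\<close> of \<open>n\<close>\<close>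
    define B where "B = 2 * ?N\<^sup>2 * C' * (L * A) * (?N * C')"
    define e where "e n = B * (real (Suc n) powr a * real n powr a / real n)" for n
    have g_inc: "\<bar>g (Suc n) y - g n y\<bar> \<le> e n" if n: "1 \<le> n" for n y
    proof -
      have "\<bar>K (Suc n) u v - K n u v\<bar> \<le> L * (A / real n)" for u v
        unfolding K_def using L increment[OF n] by (meson mult_left_mono order_trans)
      then have "\<bar>g (Suc n) y - g n y\<bar> \<le>
          2 * ?N\<^sup>2 * R (Suc n) * (L * (A / real n)) * ((?N * C') * real n powr a)"
        by (intro poisson_perturbation[OF K rev less_imp_le[OF m_pos] m_sum R, where K = "K n"])
          (auto simp: g g0 g_bound[OF n])
      also have "\<dots> \<le> 2 * ?N\<^sup>2 * (C' * real (Suc n) powr a) * (L * (A / real n)) * ((?N * C') * real n powr a)"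
        using R_le[of "Suc n"] L A0 C' by (intro mult_right_mono mult_left_mono) auto
      also have "\<dots> = e n" by (simp add: e_def B_def)
      finally show ?thesis .
    qed
    have "(\<lambda>n. real (Suc n) powr a * real n powr a / real n) \<longlonglongrightarrow> 0"
      using a1 by real_asymp
    then have e_lim: "e \<longlonglongrightarrow> 0" unfolding e_def by (intro tendsto_mult_right_zero)
    have "AE w in P. (\<lambda>n. (\<Sum>i=1..n. f (X i w)) / real n) \<longlonglongrightarrow> argmin_law \<pi>0 U x"
      by (rule ergodic_average_tendsto[OF P _ K a0 a1 g_bound g g_inc e_lim c_lim])
        (use X in \<open>simp_all add: K_def\<close>)
    then show ?thesis by (simp add: f_def)
  qed
  then have "AE w in P. \<forall>x. (\<lambda>n. (\<Sum>i=1..n. indicator {x} (X i w)) / real n) \<longlonglongrightarrow> argmin_law \<pi>0 U x"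
    by (simp add: AE_all_countable)
  moreover have "empirical_occupation X n w x = (\<Sum>i=1..n. indicator {x} (X i w)) / real n" for n w x
    unfolding empirical_occupation_def
    by (intro arg_cong[where f="\<lambda>u. u / real n"] sum.cong refl) (auto simp: indicator_def)
  ultimately show "AE w in P. \<forall>x. (\<lambda>n. empirical_occupation X n w x) \<longlonglongrightarrow> argmin_law \<pi>0 U x"
    by simp
qed

end
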